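(* There exists a sequence of Riemannian metrics $h_k$ on the torus $\mathbb{T}^2$, with constant curvature and volume equal to $1$, which is unbounded in the moduli space and such that, for every $y\in\mathbb{T}^2$, $$\sup_{t>0}\; t^2\,\mathrm{vol}_{h_k}\Big(\big\{x\in\mathbb{T}^2\;:\;|d_xG_{h_k}(x,y)|_{h_k}\ge t\big\}\Big)\longrightarrow+\infty\quad\text{as }k\to+\infty .$$
   Context: $G_{h}$ denotes a Green function associated to the metric $h$, i.e. for each $y$, $(\Delta_{h})_xG_{h}(\cdot,y)=\delta_y-\frac{1}{\mathrm{vol}(\mathbb{T}^2,h)}$ in the sense of distributions, where $\Delta_h$ is the Laplace-Beltrami operator; it is unique up to additive normalization. The norm of the differential in $x$ and the measure of the superlevel set are computed with respect to the intrinsic metric $h_k$. "Unbounded in the moduli space" means that the conformal classes of $h_k$ are not contained in any compact subset of the moduli space of conformal structures on the torus. *)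

theory Defs
  imports "HOL-Analysis.Analysis"
begin

text \<open>
  The torus is \<open>\<real>\<^sup>2 / \<int>\<^sup>2\<close>.  A function, tensor field or metric on it is represented by its
  \<open>\<int>\<^sup>2\<close>-periodic lift to \<open>real^2\<close>, expressed in the global coordinate frame; a point is
  represented by any of its lifts.
\<close>

definition int_lattice :: "(real^2) set" where
  "int_lattice = {n. \<forall>i. n $ i \<in> \<int>}"

definition torus_periodic :: "(real^2 \<Rightarrow> 'a) \<Rightarrow> bool" where
  "torus_periodic f \<longleftrightarrow> (\<forall>x. \<forall>n\<in>int_lattice. f (x + n) = f x)"

definition unit_cell :: "(real^2) set" where
  "unit_cell = {x. \<forall>i. 0 \<le> x $ i \<and> x $ i < 1}"


subsection \<open>Smooth functions\<close>

definition pd :: "2 \<Rightarrow> (real^2 \<Rightarrow> real) \<Rightarrow> real^2 \<Rightarrow> real" where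
  "pd i f x = frechet_derivative f (at x) (axis i 1)"

definition pds :: "2 list \<Rightarrow> (real^2 \<Rightarrow> real) \<Rightarrow> real^2 \<Rightarrow> real" where
  "pds is f = foldr pd is f"

text \<open>On an open set, being \<open>C\<^sup>\<infinity>\<close> is the same as having iterated partial derivatives of all
  orders that are all (totally) differentiable, since these are then continuous.\<close>

definition smooth_on :: "(real^2) set \<Rightarrow> (real^2 \<Rightarrow> real) \<Rightarrow> bool" where
  "smooth_on S f \<longleftrightarrow> (\<forall>is. \<forall>x\<in>S. pds is f differentiable (at x))"


subsection \<open>Riemannian metrics on the torus\<close>

definition torus_metric :: "(real^2 \<Rightarrow> real^2^2) \<Rightarrow> bool" where
  "torus_metric g \<longleftrightarrow>
     torus_periodic g \<and>
     (\<forall>i j. smooth_on UNIV (\<lambda>x. g x $ i $ j)) \<and>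
     (\<forall>x. transpose (g x) = g x) \<and>
     (\<forall>x v. v \<noteq> 0 \<longrightarrow> v \<bullet> (g x *v v) > 0)"

definition christoffel :: "(real^2 \<Rightarrow> real^2^2) \<Rightarrow> 2 \<Rightarrow> 2 \<Rightarrow> 2 \<Rightarrow> real^2 \<Rightarrow> real" where
  "christoffel g k i j x =
     (1/2) * (\<Sum>l\<in>UNIV. matrix_inv (g x) $ k $ l *
        (pd i (\<lambda>z. g z $ j $ l) x + pd j (\<lambda>z. g z $ i $ l) x - pd l (\<lambda>z. g z $ i $ j) x))"

text \<open>The \<open>l\<close>-th component of \<open>R(\<partial>\<^sub>i, \<partial>\<^sub>j)\<partial>\<^sub>k\<close>, where
  \<open>R(X,Y) = \<nabla>\<^sub>X\<nabla>\<^sub>Y - \<nabla>\<^sub>Y\<nabla>\<^sub>X - \<nabla>\<^bsub>[X,Y]\<^esub>\<close>.\<close>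

definition riemann :: "(real^2 \<Rightarrow> real^2^2) \<Rightarrow> 2 \<Rightarrow> 2 \<Rightarrow> 2 \<Rightarrow> 2 \<Rightarrow> real^2 \<Rightarrow> real" where
  "riemann g l i j k x =
     pd i (christoffel g l j k) x - pd j (christoffel g l i k) x +
     (\<Sum>m\<in>UNIV. christoffel g m j k x * christoffel g l i m x
                - christoffel g m i k x * christoffel g l j m x)"

text \<open>\<open>K = \<langle>R(\<partial>\<^sub>1, \<partial>\<^sub>2)\<partial>\<^sub>2, \<partial>\<^sub>1\<rangle> / det g\<close>\<close>

definition gauss_curvature :: "(real^2 \<Rightarrow> real^2^2) \<Rightarrow> real^2 \<Rightarrow> real" where
  "gauss_curvature g x = (\<Sum>l\<in>UNIV. g x $ l $ 1 * riemann g l 1 2 2 x) / det (g x)"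

definition constant_curvature :: "(real^2 \<Rightarrow> real^2^2) \<Rightarrow> bool" where
  "constant_curvature g \<longleftrightarrow> (\<exists>c. \<forall>x. gauss_curvature g x = c)"

text \<open>The Riemannian measure of the torus, carried by a fundamental domain; the measure of a
  subset of the torus is the value at its periodic lift.\<close>

definition torus_vol :: "(real^2 \<Rightarrow> real^2^2) \<Rightarrow> (real^2) measure" where
  "torus_vol g = density lborel (\<lambda>x. indicator unit_cell x * ennreal (sqrt (det (g x))))"

definition laplace_beltrami ::
    "(real^2 \<Rightarrow> real^2^2) \<Rightarrow> (real^2 \<Rightarrow> real) \<Rightarrow> real^2 \<Rightarrow> real" where
  "laplace_beltrami g f x =
     (\<Sum>i\<in>UNIV. pd i (\<lambda>z. sqrt (det (g z)) * (\<Sum>j\<in>UNIV. matrix_inv (g z) $ i $ j * pd j f z)) x)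
       / sqrt (det (g x))"

definition norm_differential ::
    "(real^2 \<Rightarrow> real^2^2) \<Rightarrow> (real^2 \<Rightarrow> real) \<Rightarrow> real^2 \<Rightarrow> real" where
  "norm_differential g f x =
     sqrt (\<Sum>i\<in>UNIV. \<Sum>j\<in>UNIV. matrix_inv (g x) $ i $ j * pd i f x * pd j f x)"


subsection \<open>Green functions\<close>

text \<open>The distributional equation
  \<open>\<Delta>\<^sub>g G(\<cdot>,y) = \<delta>\<^sub>y - 1/vol\<close> determines \<open>G(\<cdot>,y)\<close> only almost everywhere (up to a constant);
  by elliptic regularity it has a representative that is smooth away from \<open>y\<close>, and this is the
  one whose differential is considered.\<close>

definition green_function :: "(real^2 \<Rightarrow> real^2^2) \<Rightarrow> (real^2 \<Rightarrow> real^2 \<Rightarrow> real) \<Rightarrow> bool" where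
  "green_function g G \<longleftrightarrow>
     (\<forall>x. torus_periodic (G x)) \<and>
     (\<forall>y. torus_periodic (\<lambda>x. G x y) \<and>
          integrable (torus_vol g) (\<lambda>x. G x y) \<and>
          smooth_on {x. x - y \<notin> int_lattice} (\<lambda>x. G x y) \<and>
          (\<forall>\<phi>. smooth_on UNIV \<phi> \<and> torus_periodic \<phi> \<longrightarrow>
             (LINT x|torus_vol g. G x y * laplace_beltrami g \<phi> x) =
             \<phi> y - (LINT x|torus_vol g. \<phi> x) / measure (torus_vol g) UNIV))"


subsection \<open>The moduli space of conformal structures\<close>

text \<open>Lifts to the plane of the orientation-preserving diffeomorphisms of the torus.\<close>

definition torus_diffeo :: "(real^2 \<Rightarrow> real^2) \<Rightarrow> bool" where
  "torus_diffeo F \<longleftrightarrow>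
     bij F \<and>
     (\<forall>i. smooth_on UNIV (\<lambda>x. F x $ i)) \<and>
     (\<forall>i. smooth_on UNIV (\<lambda>x. inv F x $ i)) \<and>
     (\<forall>x. \<forall>n\<in>int_lattice. F (x + n) - F x \<in> int_lattice) \<and>
     (\<forall>x. \<forall>n\<in>int_lattice. inv F (x + n) - inv F x \<in> int_lattice) \<and>
     (\<forall>x. det (jacobian F (at x)) > 0)"

definition pullback_metric ::
    "(real^2 \<Rightarrow> real^2) \<Rightarrow> (real^2 \<Rightarrow> real^2^2) \<Rightarrow> real^2 \<Rightarrow> real^2^2" where
  "pullback_metric F g x =
     transpose (jacobian F (at x)) ** g (F x) ** jacobian F (at x)"

definition moduli_class :: "(real^2 \<Rightarrow> real^2^2) \<Rightarrow> (real^2 \<Rightarrow> real^2^2) set" where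
  "moduli_class g =
     {g'. torus_metric g' \<and>
          (\<exists>F u. torus_diffeo F \<and> smooth_on UNIV u \<and> torus_periodic u \<and>
                 (\<forall>x. g' x = exp (2 * u x) *\<^sub>R pullback_metric F g x))}"

text \<open>The \<open>C\<^sup>\<infinity>\<close> topology on the space of metrics: uniform convergence of all partial derivatives
  of the components.\<close>

definition metric_nhd :: "(real^2 \<Rightarrow> real^2^2) \<Rightarrow> nat \<Rightarrow> real \<Rightarrow> (real^2 \<Rightarrow> real^2^2) set" where
  "metric_nhd g N e =
     {g'. torus_metric g' \<and>
          (\<forall>is i j x. length is \<le> N \<longrightarrow>
             \<bar>pds is (\<lambda>z. g' z $ i $ j) x - pds is (\<lambda>z. g z $ i $ j) x\<bar> < e)}"

definition metric_open :: "(real^2 \<Rightarrow> real^2^2) set \<Rightarrow> bool" where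
  "metric_open U \<longleftrightarrow>
     (\<forall>g\<in>U. torus_metric g) \<and> (\<forall>g\<in>U. \<exists>N e. e > 0 \<and> metric_nhd g N e \<subseteq> U)"

definition metric_topology :: "(real^2 \<Rightarrow> real^2^2) topology" where
  "metric_topology = topology metric_open"

lemma istopology_metric_open: "istopology metric_open"
proof -
  have "metric_open (S \<inter> T)" if S: "metric_open S" and T: "metric_open T" for S T
    unfolding metric_open_def
  proof (intro conjI ballI)
    fix g assume g: "g \<in> S \<inter> T"
    then show "torus_metric g" using S by (auto simp: metric_open_def)
    obtain N e where 1: "e > 0" "metric_nhd g N e \<subseteq> S"
      using S g unfolding metric_open_def by blast
    obtain N' e' where 2: "e' > 0" "metric_nhd g N' e' \<subseteq> T"
      using T g unfolding metric_open_def by blast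
    have "metric_nhd g (max N N') (min e e') \<subseteq> metric_nhd g N e \<inter> metric_nhd g N' e'"
      unfolding metric_nhd_def by auto
    with 1 2 show "\<exists>N e. e > 0 \<and> metric_nhd g N e \<subseteq> S \<inter> T"
      by (intro exI[of _ "max N N'"] exI[of _ "min e e'"]) auto
  qed
  moreover have "metric_open (\<Union>\<K>)" if "\<forall>K\<in>\<K>. metric_open K" for \<K>
    using that unfolding metric_open_def by (meson Union_iff Union_upper subset_trans)
  ultimately show ?thesis unfolding istopology_def by blast
qed

lemma openin_metric_topology: "openin metric_topology = metric_open"
  by (simp add: metric_topology_def istopology_metric_open)

lemma topspace_metric_topology: "topspace metric_topology = Collect torus_metric"
proof -
  have "metric_open (Collect torus_metric)"
    unfolding metric_open_def metric_nhd_def by (auto intro!: exI[of _ "1::real"])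
  then show ?thesis
    unfolding topspace_def openin_metric_topology
    by (auto simp: metric_open_def intro!: exI[of _ "Collect torus_metric"])
qed

definition moduli_space :: "(real^2 \<Rightarrow> real^2^2) set set" where
  "moduli_space = moduli_class ` Collect torus_metric"

definition moduli_open :: "(real^2 \<Rightarrow> real^2^2) set set \<Rightarrow> bool" where
  "moduli_open U \<longleftrightarrow>
     U \<subseteq> moduli_space \<and>
     openin metric_topology {g \<in> topspace metric_topology. moduli_class g \<in> U}"

definition moduli_topology :: "(real^2 \<Rightarrow> real^2^2) set topology" where
  "moduli_topology = topology moduli_open"

lemma istopology_moduli_open: "istopology moduli_open"
proof -
  let ?P = "\<lambda>U. {g \<in> topspace metric_topology. moduli_class g \<in> U}"
  have "moduli_open (S \<inter> T)" if "moduli_open S" "moduli_open T" for S T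
  proof -
    have "?P (S \<inter> T) = ?P S \<inter> ?P T" by blast
    with that show ?thesis by (auto simp: moduli_open_def)
  qed
  moreover have "moduli_open (\<Union>\<K>)" if "\<forall>K\<in>\<K>. moduli_open K" for \<K>
  proof -
    have "?P (\<Union>\<K>) = (\<Union>K\<in>\<K>. ?P K)" by blast
    moreover have "openin metric_topology (\<Union>K\<in>\<K>. ?P K)"
      using that unfolding moduli_open_def by (intro openin_Union) blast
    ultimately show ?thesis using that unfolding moduli_open_def by (simp add: Sup_least)
  qed
  ultimately show ?thesis unfolding istopology_def by blast
qed

lemma openin_moduli_topology: "openin moduli_topology = moduli_open"
  by (simp add: moduli_topology_def istopology_moduli_open)

lemma topspace_moduli_topology: "topspace moduli_topology = moduli_space"
proof -
  have "{g \<in> topspace metric_topology. moduli_class g \<in> moduli_space} = topspace metric_topology"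
    by (auto simp: moduli_space_def topspace_metric_topology)
  then have "moduli_open moduli_space"
    by (simp add: moduli_open_def)
  then show ?thesis
    unfolding topspace_def openin_moduli_topology
    by (auto simp: moduli_open_def intro!: exI[of _ moduli_space])
qed

lemma quotient_map_moduli_class: "quotient_map metric_topology moduli_topology moduli_class"
  unfolding quotient_map_def
  by (auto simp: openin_moduli_topology moduli_open_def topspace_moduli_topology
      topspace_metric_topology moduli_space_def)

definition unbounded_in_moduli :: "(nat \<Rightarrow> real^2 \<Rightarrow> real^2^2) \<Rightarrow> bool" where
  "unbounded_in_moduli h \<longleftrightarrow>
     \<not> (\<exists>K. compactin moduli_topology K \<and> (\<forall>k. moduli_class (h k) \<in> K))"

end

theory Submission
  imports Defs
begin

text \<open>
  Take the flat tori \<open>h\<^sub>k = diag(a\<^sup>2, 1/a\<^sup>2)\<close> with \<open>a = k + 1\<close>.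

  Gradient: testing the Green equation with \<open>cos 2\<pi>(x\<^sub>1 - y\<^sub>1)\<close> and integrating by parts along the
  lines \<open>x\<^sub>2 = const\<close> that miss the pole gives
  \<open>\<integral> \<partial>\<^sub>1G sin 2\<pi>(x\<^sub>1 - y\<^sub>1) = a\<^sup>2/2\<pi>\<close>, hence \<open>\<integral> |dG| \<ge> a/2\<pi>\<close>.  Since the volume is \<open>1\<close>, the \<open>L\<^sup>1\<close>
  norm is at most \<open>1 + 2C\<close>, where \<open>C\<close> is the supremum in question.  If \<open>C = \<infinity>\<close> nothing is to be
  shown; otherwise the same bound provides the integrability needed for Fubini, so no regularity
  of \<open>G\<close> at the pole is used.

  Moduli: the least Dirichlet energy of an essential map to the circle \<open>\<real>/\<int>\<close> is invariant under
  diffeomorphisms and conformal changes, is positive for every metric, and exceeding a given bound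
  is an open condition.  It is therefore bounded away from \<open>0\<close> on compact subsets of the moduli
  space, whereas the first coordinate has energy \<open>1/a\<^sup>2\<close> on \<open>h\<^sub>k\<close>.
\<close>

subsection \<open>Differentiation and integration on the torus\<close>

lemma pd_eq: "(f has_derivative D) (at x) \<Longrightarrow> pd i f x = D (axis i 1)"
  unfolding pd_def by (metis frechet_derivative_at)

lemma pd_const [simp]: "pd i (\<lambda>x. c) = (\<lambda>x. 0)"
  by (rule ext) (simp add: pd_eq[OF has_derivative_const])

lemma has_derivative_pd:
  assumes "f differentiable (at x)"
  shows "(f has_derivative (\<lambda>v. v $ 1 * pd 1 f x + v $ 2 * pd 2 f x)) (at x)"
proof -
  let ?D = "frechet_derivative f (at x)"
  have D: "(f has_derivative ?D) (at x)"
    using assms frechet_derivative_works by blast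
  have "?D v = v $ 1 * pd 1 f x + v $ 2 * pd 2 f x" for v
  proof -
    have v: "v = v $ 1 *\<^sub>R axis 1 1 + v $ 2 *\<^sub>R axis 2 1"
      by (simp add: vec_eq_iff forall_2 axis_def)
    have "?D v = v $ 1 *\<^sub>R ?D (axis 1 1) + v $ 2 *\<^sub>R ?D (axis 2 1)"
      by (subst v) (simp only: linear_add linear_scale has_derivative_linear[OF D])
    then show ?thesis by (simp add: pd_def)
  qed
  then show ?thesis using D by (metis (no_types, lifting) ext)
qed

lemma smooth_onD:
  assumes "smooth_on S f" "x \<in> S"
  shows "f differentiable (at x)" "pd i f differentiable (at x)"
  using assms(1)[unfolded smooth_on_def, rule_format, OF assms(2), of "[]"]
    assms(1)[unfolded smooth_on_def, rule_format, OF assms(2), of "[i]"]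
  by (simp_all add: pds_def)

lemma smooth_on_const: "smooth_on S (\<lambda>x. c)"
proof -
  have "\<exists>d. pds is (\<lambda>x. c) = (\<lambda>x. d)" for "is"
    by (induction "is") (auto simp: pds_def)
  then show ?thesis unfolding smooth_on_def by (metis differentiable_const)
qed

lemma has_derivative_component:
  assumes "(f has_real_derivative f') (at (x $ i))"
  shows "((\<lambda>x::real^2. f (x $ i)) has_derivative (\<lambda>v. v $ i * f')) (at x)"
  by (rule DERIV_compose_FDERIV[where g = "\<lambda>x. x $ i", OF assms])
    (rule bounded_linear_imp_has_derivative[OF bounded_linear_vec_nth])

text \<open>\<open>D\<close> lists the successive derivatives of \<open>D 0\<close>. By induction
  every iterated partial derivative is a constant multiple of some \<open>D n\<close> in the same
  coordinate, hence differentiable.\<close>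

lemma smooth_on_component:
  fixes D :: "nat \<Rightarrow> real \<Rightarrow> real"
  assumes D: "\<And>n t. (D n has_real_derivative D (Suc n) t) (at t)"
  shows "smooth_on S (\<lambda>x. D 0 (x $ i))"
proof -
  have hd: "((\<lambda>x::real^2. c * D n (x $ i)) has_derivative (\<lambda>v. c * (v $ i * D (Suc n) (x $ i)))) (at x)"
    for c n x by (rule has_derivative_mult_right[OF has_derivative_component[OF D]])
  have "\<exists>c n. pds is (\<lambda>x. D 0 (x $ i)) = (\<lambda>x. c * D n (x $ i))" for "is"
  proof (induction "is")
    case Nil
    show ?case by (rule exI[of _ 1], rule exI[of _ 0]) (simp add: pds_def)
  next
    case (Cons j js)
    then obtain c n where "pds js (\<lambda>x. D 0 (x $ i)) = (\<lambda>x. c * D n (x $ i))" by auto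
    then have "pds (j # js) (\<lambda>x. D 0 (x $ i)) = (\<lambda>x. (c * axis j 1 $ i) * D (Suc n) (x $ i))"
      by (auto simp: pds_def pd_eq[OF hd])
    then show ?case by blast
  qed
  then show ?thesis
    unfolding smooth_on_def using hd by (metis differentiableI)
qed

section \<open>Slicing integrals along coordinate lines\<close>

text \<open>For fixed \<open>t\<close>, \<open>s\<close> runs along a line parallel to the
  \<open>i\<close>-th axis. Keeping \<open>i\<close> as a parameter matters because the direction in
  which an essential map winds is not known in advance.\<close>

definition pt :: "2 \<Rightarrow> real \<Rightarrow> real \<Rightarrow> real^2" where
  "pt i s t = (\<chi> j. if j = i then s else t)"

lemma continuous_on_pt [continuous_intros]:
  "continuous_on S f \<Longrightarrow> continuous_on S g \<Longrightarrow> continuous_on S (\<lambda>x. pt i (f x) (g x))"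
  unfolding pt_def
  by (intro continuous_on_vec_lambda, rename_tac j, case_tac "j = i") auto

lemma measurable_pt [measurable]:
  "(\<lambda>p. pt i (fst p) (snd p)) \<in> borel_measurable (lborel \<Otimes>\<^sub>M lborel)"
  by (simp add: lborel_prod, intro borel_measurable_continuous_onI continuous_intros)

text \<open>Lebesgue measure is determined by its values on open boxes, and the preimage of a box is
  a product of two intervals.\<close>

lemma distr_pt: "distr (lborel \<Otimes>\<^sub>M lborel) borel (\<lambda>p. pt i (fst p) (snd p)) = lborel"
proof (rule lborel_eqI[symmetric])
  fix l u :: "real^2"
  assume lu: "\<And>b. b \<in> Basis \<Longrightarrow> l \<bullet> b \<le> u \<bullet> b"
  have le: "l $ j \<le> u $ j" for j
    using lu[of "axis j 1"] by (simp add: inner_axis)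
  define j where "j = (if i = 1 then 2 else 1 :: 2)"
  have ij: "UNIV = {i, j}" "i \<noteq> j"
    using exhaust_2[of i] by (auto simp: j_def UNIV_2)
  have all: "(\<forall>k. P k) \<longleftrightarrow> P i \<and> P j" for P
    using ij(1) by (metis UNIV_I insertE singletonD)
  have pre: "(\<lambda>p. pt i (fst p) (snd p)) -` box l u \<inter> space (lborel \<Otimes>\<^sub>M lborel)
      = {l$i<..<u$i} \<times> {l$j<..<u$j}"
    using ij(2) by (auto simp: mem_box_cart space_pair_measure pt_def all)
  have "emeasure (distr (lborel \<Otimes>\<^sub>M lborel) borel (\<lambda>p. pt i (fst p) (snd p))) (box l u)
      = emeasure lborel {l$i<..<u$i} * emeasure lborel {l$j<..<u$j}"
    by (simp add: emeasure_distr pre lborel.emeasure_pair_measure_Times)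
  also have "\<dots> = ennreal ((u$i - l$i) * (u$j - l$j))"
    using le by (simp add: ennreal_mult)
  also have "(u$i - l$i) * (u$j - l$j) = (\<Prod>b\<in>Basis. (u - l) \<bullet> b)"
  proof -
    have B: "(Basis :: (real^2) set) = (\<lambda>k. axis k 1) ` UNIV"
      by (auto simp: Basis_vec_def)
    have "(\<Prod>b\<in>Basis. (u - l) \<bullet> b) = (\<Prod>k\<in>UNIV. (u - l) $ k)"
      unfolding B by (subst prod.reindex) (auto simp: inj_on_def axis_eq_axis inner_axis)
    also have "\<dots> = (u - l) $ i * (u - l) $ j"
      using ij(2) by (subst ij(1)) simp
    finally show ?thesis by simp
  qed
  finally show "emeasure (distr (lborel \<Otimes>\<^sub>M lborel) borel (\<lambda>p. pt i (fst p) (snd p))) (box l u)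
      = (\<Prod>b\<in>Basis. (u - l) \<bullet> b)" .
qed simp

lemma nn_integral_lborel_pt:
  assumes [measurable]: "f \<in> borel_measurable borel"
  shows "(\<integral>\<^sup>+x. f x \<partial>lborel) = (\<integral>\<^sup>+t. \<integral>\<^sup>+s. f (pt i s t) \<partial>lborel \<partial>lborel)"
proof -
  have "(\<integral>\<^sup>+x. f x \<partial>lborel) = (\<integral>\<^sup>+p. f (pt i (fst p) (snd p)) \<partial>(lborel \<Otimes>\<^sub>M lborel))"
    by (subst distr_pt[of i, symmetric]) (simp add: nn_integral_distr)
  also have "\<dots> = (\<integral>\<^sup>+t. \<integral>\<^sup>+s. f (pt i s t) \<partial>lborel \<partial>lborel)"
    by (subst lborel_pair.nn_integral_snd[symmetric]) auto
  finally show ?thesis .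
qed

lemma integral_lborel_pt:
  fixes f :: "real^2 \<Rightarrow> real"
  assumes f: "integrable lborel f"
  shows "integral\<^sup>L lborel f = (\<integral>t. \<integral>s. f (pt i s t) \<partial>lborel \<partial>lborel)"
proof -
  have [measurable]: "f \<in> borel_measurable borel" using f by auto
  have 1: "integral\<^sup>L lborel f = (\<integral>p. f (pt i (fst p) (snd p)) \<partial>(lborel \<Otimes>\<^sub>M lborel))"
    by (subst distr_pt[of i, symmetric]) (simp add: integral_distr)
  have "integrable (distr (lborel \<Otimes>\<^sub>M lborel) borel (\<lambda>p. pt i (fst p) (snd p))) f"
    using f by (simp add: distr_pt)
  then have "integrable (lborel \<Otimes>\<^sub>M lborel) (\<lambda>p. f (pt i (fst p) (snd p)))"
    by (simp add: integrable_distr_eq)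
  then have 2: "integrable (lborel \<Otimes>\<^sub>M lborel) (case_prod (\<lambda>s t. f (pt i s t)))"
    by (simp add: case_prod_beta')
  show ?thesis unfolding 1
    using lborel_pair.integral_snd[OF 2] by (simp add: case_prod_beta')
qed

lemma unit_cell_measurable [measurable]: "unit_cell \<in> sets borel"
  unfolding unit_cell_def by measurable

lemma indicator_unit_cell_pt:
  "(indicator unit_cell (pt i s t) :: 'a::semiring_1) = indicator {0..<1} s * indicator {0..<1} t"
proof -
  define j where "j = (if i = 1 then 2 else 1 :: 2)"
  have ij: "UNIV = {i, j}" "i \<noteq> j"
    using exhaust_2[of i] by (auto simp: j_def UNIV_2)
  have all: "(\<forall>k. P k) \<longleftrightarrow> P i \<and> P j" for P
    using ij(1) by (metis UNIV_I insertE singletonD)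
  show ?thesis using ij(2)
    by (auto simp: unit_cell_def pt_def all indicator_def)
qed

lemma has_real_derivative_pt:
  assumes "f differentiable (at (pt i s t))"
  shows "((\<lambda>s. f (pt i s t)) has_real_derivative pd i f (pt i s t)) (at s)"
proof -
  let ?D = "frechet_derivative f (at (pt i s t))"
  have D: "(f has_derivative ?D) (at (pt i s t))"
    using assms frechet_derivative_works by blast
  have eq: "pt i s t = pt i 0 t + s *\<^sub>R axis i 1" for s
    by (auto simp: pt_def axis_def vec_eq_iff)
  have "((\<lambda>s. pt i s t) has_derivative (\<lambda>h. h *\<^sub>R axis i 1)) (at s)"
    by (subst eq) (auto intro!: derivative_eq_intros)
  from has_derivative_compose[OF this D]
  have "((\<lambda>s. f (pt i s t)) has_derivative (\<lambda>h. ?D (h *\<^sub>R axis i 1))) (at s)" .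
  moreover have "?D (h *\<^sub>R axis i 1) = pd i f (pt i s t) * h" for h
    by (simp add: linear_scale[OF has_derivative_linear[OF D]] pd_def)
  ultimately show ?thesis
    by (simp add: has_field_derivative_def)
qed

lemma pt_add_axis: "pt i (s + 1) t = pt i s t + axis i 1"
  by (auto simp: pt_def axis_def vec_eq_iff)

lemma axis_in_int_lattice [simp]: "axis i 1 \<in> int_lattice"
  by (auto simp: int_lattice_def axis_def)

lemma emeasure_unit_cell [simp]: "emeasure lborel unit_cell = 1"
proof -
  have "emeasure lborel unit_cell = (\<integral>\<^sup>+x. indicator unit_cell x \<partial>lborel)"
    by simp
  also have "\<dots> = (\<integral>\<^sup>+t. \<integral>\<^sup>+s. indicator {0..<1::real} s * indicator {0..<1::real} t \<partial>lborel \<partial>lborel)"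
    by (subst nn_integral_lborel_pt[of _ 1]) (auto simp: indicator_unit_cell_pt)
  also have "\<dots> = 1"
    by (simp add: nn_integral_multc)
  finally show ?thesis .
qed

section \<open>The lattice and its fundamental domain\<close>

lemma int_lattice_eq: "int_lattice = range (\<lambda>p :: int \<times> int. of_int (fst p) *\<^sub>R axis 1 1 + of_int (snd p) *\<^sub>R axis 2 1)"
proof -
  have "n \<in> int_lattice \<Longrightarrow> n = of_int \<lfloor>n $ 1\<rfloor> *\<^sub>R axis 1 1 + of_int \<lfloor>n $ 2\<rfloor> *\<^sub>R axis 2 1" for n
    by (auto simp: int_lattice_def vec_eq_iff forall_2 axis_def)
  moreover have "of_int k *\<^sub>R axis 1 1 + of_int l *\<^sub>R axis 2 1 \<in> int_lattice" for k l
    by (auto simp: int_lattice_def axis_def)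
  ultimately show ?thesis by (force simp: image_iff)
qed

lemma countable_int_lattice: "countable int_lattice"
  unfolding int_lattice_eq by simp

lemma int_lattice_diff: "m \<in> int_lattice \<Longrightarrow> n \<in> int_lattice \<Longrightarrow> m - n \<in> int_lattice"
  by (auto simp: int_lattice_def)

lemma int_lattice_uminus: "m \<in> int_lattice \<Longrightarrow> - m \<in> int_lattice"
  by (auto simp: int_lattice_def)

lemma unit_cell_translate:
  obtains n where "n \<in> int_lattice" "x + n \<in> unit_cell"
    "\<And>m. m \<in> int_lattice \<Longrightarrow> x + m \<in> unit_cell \<Longrightarrow> m = n"
proof
  let ?n = "(\<chi> i. - of_int \<lfloor>x $ i\<rfloor>) :: real^2"
  show "?n \<in> int_lattice" by (auto simp: int_lattice_def)
  show "x + ?n \<in> unit_cell" by (auto simp: unit_cell_def) linarith+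
  fix m assume m: "m \<in> int_lattice" "x + m \<in> unit_cell"
  show "m = ?n"
    unfolding vec_eq_iff
  proof
    fix i
    obtain k where k: "m $ i = of_int k" using m by (auto simp: int_lattice_def elim: Ints_cases)
    have "0 \<le> x $ i + of_int k" "x $ i + of_int k < 1"
      using m(2) unfolding unit_cell_def mem_Collect_eq by (metis k vector_add_component)+
    then have "\<lfloor>x $ i\<rfloor> = - k" by linarith
    then show "m $ i = ?n $ i" by (simp add: k)
  qed
qed

lemma unit_cell_inj_mod_lattice:
  assumes "x \<in> unit_cell" "y \<in> unit_cell" "x - y \<in> int_lattice"
  shows "x = y"
proof -
  obtain n where "\<And>m. m \<in> int_lattice \<Longrightarrow> y + m \<in> unit_cell \<Longrightarrow> m = n"
    using unit_cell_translate[of y] by metis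
  from this[of 0] this[of "x - y"] show ?thesis
    using assms by (auto simp: int_lattice_def)
qed

text \<open>This is compactness of the torus: every value is already taken on the closed unit
  square. Applied to negated functions it also gives upper bounds.\<close>

lemma torus_periodic_attains_inf:
  fixes f :: "real^2 \<Rightarrow> real"
  assumes f: "torus_periodic f" "continuous_on UNIV f"
  obtains z where "\<And>x. f z \<le> f x"
proof -
  have "compact (cbox 0 1 :: (real^2) set)" "cbox 0 1 \<noteq> ({} :: (real^2) set)"
    by (auto simp: interval_ne_empty_cart)
  then obtain z where z: "\<And>x. x \<in> cbox 0 1 \<Longrightarrow> f z \<le> f x"
    using continuous_attains_inf[of "cbox 0 1" f] continuous_on_subset[OF f(2)] by blast
  have "f z \<le> f x" for x
  proof -
    obtain n where n: "n \<in> int_lattice" "x + n \<in> unit_cell"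
      using unit_cell_translate by blast
    then have "x + n \<in> cbox 0 1"
      by (auto simp: unit_cell_def mem_box_cart less_imp_le)
    then show ?thesis using z n f(1) by (force simp: torus_periodic_def)
  qed
  then show ?thesis using that by blast
qed

text \<open>Cutting \<open>A\<close> along the lattice and translating the pieces back into the unit cell, they
  stay disjoint.\<close>

lemma nn_integral_periodic_le:
  fixes \<phi> :: "real^2 \<Rightarrow> ennreal"
  assumes [measurable]: "\<phi> \<in> borel_measurable borel" "A \<in> sets borel"
    and per: "torus_periodic \<phi>"
    and inj: "\<And>x y. x \<in> A \<Longrightarrow> y \<in> A \<Longrightarrow> x - y \<in> int_lattice \<Longrightarrow> x = y"
  shows "(\<integral>\<^sup>+x. \<phi> x * indicator A x \<partial>lborel) \<le> (\<integral>\<^sup>+x. \<phi> x * indicator unit_cell x \<partial>lborel)"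
proof -
  let ?L = "count_space int_lattice"
  have cell: "(\<integral>\<^sup>+n. indicator unit_cell (x + n) \<partial>?L) = 1" for x
  proof -
    obtain n0 where n0: "n0 \<in> int_lattice" "x + n0 \<in> unit_cell"
      "\<And>m. m \<in> int_lattice \<Longrightarrow> x + m \<in> unit_cell \<Longrightarrow> m = n0"
      using unit_cell_translate by metis
    have "x + n \<in> unit_cell \<longleftrightarrow> n = n0" if "n \<in> int_lattice" for n
      using n0 that by blast
    then have "(\<integral>\<^sup>+n. indicator unit_cell (x + n) \<partial>?L) = (\<integral>\<^sup>+n. indicator {n0} n \<partial>?L)"
      by (intro nn_integral_cong) (simp add: indicator_def)
    also have "\<dots> = 1" using n0(1) by simp
    finally show ?thesis .
  qed
  \<comment> \<open>Two lattice translates of \<open>x\<close> in \<open>A\<close> would differ by a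
    lattice vector, so \<open>inj\<close> leaves at most one.\<close>
  have A: "(\<integral>\<^sup>+n. indicator A (x - n) \<partial>?L) \<le> 1" for x
  proof (cases "\<exists>n0\<in>int_lattice. x - n0 \<in> A")
    case True
    then obtain n0 where n0: "n0 \<in> int_lattice" "x - n0 \<in> A" by blast
    have "x - n \<in> A \<longleftrightarrow> n = n0" if n: "n \<in> int_lattice" for n
      using inj[OF _ n0(2), of "x - n"] int_lattice_diff[OF n0(1) n] n0(2) by auto
    then have "(\<integral>\<^sup>+n. indicator A (x - n) \<partial>?L) \<le> (\<integral>\<^sup>+n. indicator {n0} n \<partial>?L)"
      by (intro nn_integral_mono) (simp add: indicator_def)
    also have "\<dots> = 1" using n0(1) by simp
    finally show ?thesis .
  next
    case False
    then have "(\<integral>\<^sup>+n. indicator A (x - n) \<partial>?L) = (\<integral>\<^sup>+n. 0 \<partial>?L)"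
      by (intro nn_integral_cong) (auto simp: indicator_def)
    then show ?thesis by simp
  qed
  \<comment> \<open>By \<open>cell\<close>, the number \<open>1\<close> is the sum of the indicators
    of the translated cells at \<open>x\<close>; inserting it cuts \<open>A\<close> into
    pieces.\<close>
  have "(\<integral>\<^sup>+x. \<phi> x * indicator A x \<partial>lborel)
      = (\<integral>\<^sup>+x. \<integral>\<^sup>+n. \<phi> x * indicator A x * indicator unit_cell (x + n) \<partial>?L \<partial>lborel)"
  proof (rule nn_integral_cong)
    show "\<phi> x * indicator A x = (\<integral>\<^sup>+n. \<phi> x * indicator A x * indicator unit_cell (x + n) \<partial>?L)" for x
      by (subst nn_integral_cmult) (simp_all add: cell)
  qed
  also have "\<dots> = (\<integral>\<^sup>+n. \<integral>\<^sup>+x. \<phi> x * indicator A x * indicator unit_cell (x + n) \<partial>lborel \<partial>?L)"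
    by (rule nn_integral_count_space_nn_integral[OF countable_int_lattice]) measurable
  \<comment> \<open>Translating by \<open>n\<close> moves the shift from the cell to
    \<open>A\<close>, while \<open>\<phi>\<close> is unchanged by periodicity.\<close>
  also have "\<dots> = (\<integral>\<^sup>+n. \<integral>\<^sup>+x. \<phi> x * indicator unit_cell x * indicator A (x - n) \<partial>lborel \<partial>?L)"
  proof (rule nn_integral_cong)
    fix n assume "n \<in> space ?L"
    then have n: "n \<in> int_lattice" by simp
    have "(\<integral>\<^sup>+x. \<phi> x * indicator A x * indicator unit_cell (x + n) \<partial>lborel)
      = (\<integral>\<^sup>+x. \<phi> x * indicator A x * indicator unit_cell (x + n) \<partial>distr lborel borel ((+) (-n)))"
      by (simp add: lborel_distr_plus)
    also have "\<dots> = (\<integral>\<^sup>+x. \<phi> (-n + x) * indicator A (-n + x) * indicator unit_cell ((-n + x) + n) \<partial>lborel)"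
      by (rule nn_integral_distr; measurable)
    also have "\<dots> = (\<integral>\<^sup>+x. \<phi> x * indicator unit_cell x * indicator A (x - n) \<partial>lborel)"
    proof (rule nn_integral_cong)
      fix x
      have "\<phi> (x + - n) = \<phi> x"
        using per int_lattice_uminus[OF n] unfolding torus_periodic_def by blast
      then show "\<phi> (-n + x) * indicator A (-n + x) * indicator unit_cell ((-n + x) + n)
          = \<phi> x * indicator unit_cell x * indicator A (x - n)"
        by (simp add: mult_ac)
    qed
    finally show "(\<integral>\<^sup>+x. \<phi> x * indicator A x * indicator unit_cell (x + n) \<partial>lborel)
      = (\<integral>\<^sup>+x. \<phi> x * indicator unit_cell x * indicator A (x - n) \<partial>lborel)" .
  qed
  also have "\<dots> = (\<integral>\<^sup>+x. \<integral>\<^sup>+n. \<phi> x * indicator unit_cell x * indicator A (x - n) \<partial>?L \<partial>lborel)"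
    by (rule nn_integral_count_space_nn_integral[OF countable_int_lattice, symmetric]) measurable
  also have "\<dots> = (\<integral>\<^sup>+x. \<phi> x * indicator unit_cell x * (\<integral>\<^sup>+n. indicator A (x - n) \<partial>?L) \<partial>lborel)"
    by (intro nn_integral_cong nn_integral_cmult) simp
  also have "\<dots> \<le> (\<integral>\<^sup>+x. \<phi> x * indicator unit_cell x * 1 \<partial>lborel)"
    by (intro nn_integral_mono mult_left_mono A) simp
  finally show ?thesis by (simp only: mult_1_right)
qed

subsection \<open>Green functions of long flat tori\<close>

text \<open>If \<open>2 ^ N\<close> is the largest power with \<open>2 ^ N \<le> r\<close>, the
  powers up to it sum to \<open>2 ^ (N + 1) - 1\<close>, which exceeds \<open>r - 1\<close>. The
  summand \<open>1\<close> also covers the case \<open>r < 1\<close>, where no power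
  contributes.\<close>

lemma dyadic_upper_bound:
  fixes r :: real
  assumes "r < 2 ^ m"
  shows "r \<le> 1 + (\<Sum>n<m. if 2 ^ n \<le> r then 2 ^ n else 0)"
  using assms
proof (induction m)
  case (Suc m)
  show ?case
  proof (cases "r < 2 ^ m")
    case True
    then show ?thesis using Suc.IH by simp
  next
    case False
    then have "2 ^ n \<le> r" if "n \<le> m" for n
      using that by (meson le_less_trans not_le one_le_numeral power_increasing)
    then have "(\<Sum>n<Suc m. if 2 ^ n \<le> r then 2 ^ n else 0) = (\<Sum>n<Suc m. 2 ^ n :: real)"
      by (intro sum.cong) auto
    also have "\<dots> = 2 ^ Suc m - 1"
      by (induction m) auto
    finally show ?thesis using Suc.prems by simp
  qed
qed simp

text \<open>Decomposing over the dyadic levels \<open>2\<^sup>n \<le> f\<close> bounds the \<open>L\<^sup>1\<close> norm on a probability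
  space by the weak \<open>L\<^sup>2\<close> quasinorm.\<close>

lemma nn_integral_le_weak_L2:
  fixes f :: "'a \<Rightarrow> real"
  assumes [measurable]: "f \<in> borel_measurable M" and M: "emeasure M (space M) = 1"
  shows "(\<integral>\<^sup>+x. ennreal (f x) \<partial>M)
    \<le> 1 + 2 * (SUP t\<in>{0<..}. ennreal (t^2) * emeasure M {x\<in>space M. t \<le> f x})"
proof -
  define C where "C = (SUP t\<in>{0<..}. ennreal (t^2) * emeasure M {x\<in>space M. t \<le> f x})"
  \<comment> \<open>Writing \<open>2 ^ n = (1/2) ^ n * (2 ^ n)\<^sup>2\<close> brings in the weak
    quasinorm at \<open>t = 2 ^ n\<close>. The remaining weights form a geometric series of sum
    \<open>2\<close>, the factor in the claim.\<close>
  have level: "ennreal (2 ^ n) * emeasure M {x\<in>space M. 2 ^ n \<le> f x} \<le> ennreal ((1/2) ^ n) * C" for n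
  proof -
    have "ennreal (2 ^ n) * emeasure M {x\<in>space M. 2 ^ n \<le> f x}
      = ennreal ((1/2) ^ n) * (ennreal ((2 ^ n)\<^sup>2) * emeasure M {x\<in>space M. 2 ^ n \<le> f x})"
      by (simp add: mult.assoc[symmetric] ennreal_mult[symmetric] power2_eq_square field_simps)
    also have "\<dots> \<le> ennreal ((1/2) ^ n) * C"
      unfolding C_def by (intro mult_left_mono SUP_upper) auto
    finally show ?thesis .
  qed
  have "ennreal (f x) \<le> 1 + (\<Sum>n. ennreal (2 ^ n) * indicator {x\<in>space M. 2 ^ n \<le> f x} x)"
    if x: "x \<in> space M" for x
  proof -
    obtain m where m: "f x < 2 ^ m"
      using real_arch_pow[of 2 "f x"] by auto
    have "ennreal (f x) \<le> ennreal (1 + (\<Sum>n<m. if 2 ^ n \<le> f x then 2 ^ n else 0))"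
      by (intro ennreal_leI dyadic_upper_bound m)
    also have "\<dots> = 1 + (\<Sum>n<m. ennreal (if 2 ^ n \<le> f x then 2 ^ n else 0))"
      by (subst ennreal_plus) (auto intro!: sum_nonneg simp: sum_ennreal)
    also have "(\<Sum>n<m. ennreal (if 2 ^ n \<le> f x then 2 ^ n else 0))
        = (\<Sum>n<m. ennreal (2 ^ n) * indicator {x\<in>space M. 2 ^ n \<le> f x} x)"
      using x by (intro sum.cong) (auto simp: indicator_def)
    also have "\<dots> \<le> (\<Sum>n. ennreal (2 ^ n) * indicator {x\<in>space M. 2 ^ n \<le> f x} x)"
      by (intro sum_le_suminf) auto
    finally show ?thesis by (simp add: add_left_mono)
  qed
  then have "(\<integral>\<^sup>+x. ennreal (f x) \<partial>M)
      \<le> (\<integral>\<^sup>+x. 1 + (\<Sum>n. ennreal (2 ^ n) * indicator {x\<in>space M. 2 ^ n \<le> f x} x) \<partial>M)"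
    by (intro nn_integral_mono) auto
  also have "\<dots> = 1 + (\<Sum>n. ennreal (2 ^ n) * emeasure M {x\<in>space M. 2 ^ n \<le> f x})"
    by (simp add: nn_integral_add nn_integral_suminf nn_integral_cmult M)
  also have "\<dots> \<le> 1 + (\<Sum>n. ennreal ((1/2) ^ n) * C)"
    by (intro add_left_mono suminf_le level) auto
  also have "(\<Sum>n. ennreal ((1/2) ^ n) * C) = (\<Sum>n. ennreal ((1/2) ^ n)) * C"
    by (simp only: ennreal_suminf_multc)
  also have "(\<Sum>n. ennreal ((1/2) ^ n)) = ennreal (\<Sum>n. (1/2) ^ n)"
    by (intro suminf_ennreal2) (auto intro: summable_geometric)
  also have "(\<Sum>n. (1/2) ^ n :: real) = 2"
    by (subst suminf_geometric) auto
  finally show ?thesis by (simp add: C_def)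
qed

text \<open>On each admissible line the fundamental theorem of calculus and periodicity give
  integral \<open>0\<close>; Fubini, justified by the integrability of \<open>w\<close>, sums the
  lines. The exceptional parameters in \<open>T\<close> form a null set, which makes it possible to
  avoid the lines through a pole.\<close>

lemma integral_unit_cell_derivative:
  fixes q w :: "real^2 \<Rightarrow> real"
  assumes w: "integrable lborel (\<lambda>x. indicator unit_cell x * w x)"
    and T: "countable T"
    and q: "\<And>s t. t \<notin> T \<Longrightarrow> ((\<lambda>s. q (pt i s t)) has_real_derivative w (pt i s t)) (at s)"
    and cont: "\<And>s t. t \<notin> T \<Longrightarrow> isCont (\<lambda>s. w (pt i s t)) s"
    and per: "\<And>t. t \<notin> T \<Longrightarrow> q (pt i 1 t) = q (pt i 0 t)"
  shows "(\<integral>x. indicator unit_cell x * w x \<partial>lborel) = 0"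
proof -
  have "(\<integral>s. indicator unit_cell (pt i s t) * w (pt i s t) \<partial>lborel) = 0" if t: "t \<notin> T" for t
  proof -
    have "(\<integral>s. indicator unit_cell (pt i s t) * w (pt i s t) \<partial>lborel)
      = (\<integral>s. indicator {0..<1} t * (w (pt i s t) * indicator {0..<1} s) \<partial>lborel)"
      by (simp add: indicator_unit_cell_pt mult_ac)
    also have "\<dots> = indicator {0..<1} t * (\<integral>s. w (pt i s t) * indicator {0..<1} s \<partial>lborel)"
      by simp
    also have "(\<integral>s. w (pt i s t) * indicator {0..<1} s \<partial>lborel)
        = (\<integral>s. w (pt i s t) * indicator {0..1} s \<partial>lborel)"
    proof (rule integral_cong_AE)
      have [measurable]: "(\<lambda>s. w (pt i s t)) \<in> borel_measurable borel"
        using cont[OF t] by (intro borel_measurable_continuous_onI continuous_at_imp_continuous_on) auto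
      show "(\<lambda>s. w (pt i s t) * indicator {0..<1} s) \<in> borel_measurable lborel"
        "(\<lambda>s. w (pt i s t) * indicator {0..1} s) \<in> borel_measurable lborel" by measurable
      show "AE s in lborel. w (pt i s t) * indicator {0..<1} s = w (pt i s t) * indicator {0..1} s"
        using AE_lborel_singleton[of "1::real"] by eventually_elim (auto simp: indicator_def)
    qed
    also have "\<dots> = q (pt i 1 t) - q (pt i 0 t)"
      using t q cont by (intro integral_FTC_Icc_real) auto
    finally show ?thesis using per[OF t] by simp
  qed
  moreover have "AE t in lborel. t \<notin> T"
    by (intro AE_not_in countable_imp_null_set_lborel T)
  ultimately have "AE t in lborel. (\<integral>s. indicator unit_cell (pt i s t) * w (pt i s t) \<partial>lborel) = 0"
    by auto
  then show ?thesis
    by (subst integral_lborel_pt[OF w, of i]) (rule integral_eq_zero_AE)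
qed

section \<open>The flat tori and their Green functions\<close>

text \<open>For \<open>a > 0\<close> this is the flat rectangular torus with side lengths
  \<open>a\<close> and \<open>1 / a\<close>, written on the unit square. The volume stays
  \<open>1\<close> while the ratio of the sides degenerates.\<close>

definition long_torus :: "real \<Rightarrow> real^2 \<Rightarrow> real^2^2" where
  "long_torus a x = (\<chi> i j. if i = j then if i = 1 then a\<^sup>2 else 1 / a\<^sup>2 else 0)"

lemma long_torus_nth [simp]:
  "long_torus a x $ 1 $ 1 = a\<^sup>2" "long_torus a x $ 2 $ 2 = 1 / a\<^sup>2"
  "long_torus a x $ 1 $ 2 = 0" "long_torus a x $ 2 $ 1 = 0"
  by (simp_all add: long_torus_def)

lemma det_long_torus [simp]: "a > 0 \<Longrightarrow> det (long_torus a x) = 1"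
  by (simp add: det_2)

lemma torus_metric_long_torus:
  assumes "a > 0"
  shows "torus_metric (long_torus a)"
  unfolding torus_metric_def
proof (intro conjI allI impI)
  show "torus_periodic (long_torus a)"
    by (simp add: torus_periodic_def long_torus_def)
  show "smooth_on UNIV (\<lambda>x. long_torus a x $ i $ j)" for i j
    by (simp add: long_torus_def smooth_on_const)
  show "transpose (long_torus a x) = long_torus a x" for x
    by (simp add: vec_eq_iff forall_2 transpose_def)
  fix x v :: "real^2" assume v: "v \<noteq> 0"
  have "v \<bullet> (long_torus a x *v v) = (a * v $ 1)\<^sup>2 + (v $ 2 / a)\<^sup>2"
    by (simp add: inner_vec_def matrix_vector_mult_def sum_2 power2_eq_square field_simps)
  moreover have "a * v $ 1 \<noteq> 0 \<or> v $ 2 / a \<noteq> 0"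
    using v assms by (auto simp: vec_eq_iff forall_2)
  ultimately show "v \<bullet> (long_torus a x *v v) > 0"
    by (metis add.commute add_nonneg_pos add_pos_nonneg zero_le_power2 zero_less_power2)
qed

text \<open>The metric coefficients are constant, so all Christoffel symbols vanish and the
  curvature is \<open>0\<close>.\<close>

lemma constant_curvature_long_torus: "constant_curvature (long_torus a)"
proof -
  have pd0: "pd l (\<lambda>z. long_torus a z $ i $ j) x = 0" for l i j x
    by (simp add: long_torus_def)
  have c: "christoffel (long_torus a) k i j = (\<lambda>x. 0)" for k i j
    by (rule ext) (simp add: christoffel_def pd0)
  have "gauss_curvature (long_torus a) x = 0" for x
    by (simp add: gauss_curvature_def riemann_def c)
  then show ?thesis unfolding constant_curvature_def by blast
qed

text \<open>\<open>matrix_inv\<close> is defined by choice; uniqueness of two-sided inverses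
  identifies it with an explicit one.\<close>

lemma matrix_inv_eqI:
  fixes A :: "'a::semiring_1^'n^'m"
  assumes "A ** B = mat 1" "B ** A = mat 1"
  shows "matrix_inv A = B"
proof -
  have "A ** matrix_inv A = mat 1 \<and> matrix_inv A ** A = mat 1"
    unfolding matrix_inv_def
    by (rule someI[of "\<lambda>A'. A ** A' = mat 1 \<and> A' ** A = mat 1" B]) (simp add: assms)
  then have "B ** (A ** matrix_inv A) = B"
    by (simp only: matrix_mul_rid simp_thms)
  then show ?thesis by (simp only: matrix_mul_assoc assms matrix_mul_lid)
qed

lemma matrix_inv_long_torus:
  assumes "a > 0"
  shows "matrix_inv (long_torus a x) = (\<chi> i j. if i = j then if i = 1 then 1 / a\<^sup>2 else a\<^sup>2 else 0)"
proof (rule matrix_inv_eqI)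
  show "long_torus a x ** (\<chi> i j. if i = j then if i = 1 then 1 / a\<^sup>2 else a\<^sup>2 else 0) = mat 1"
    "(\<chi> i j. if i = j then if i = 1 then 1 / a\<^sup>2 else a\<^sup>2 else 0) ** long_torus a x = mat 1"
    using assms by (simp_all add: vec_eq_iff forall_2 matrix_matrix_mult_def sum_2 mat_def)
qed

lemma torus_vol_long_torus:
  "a > 0 \<Longrightarrow> torus_vol (long_torus a) = density lborel (\<lambda>x. ennreal (indicator unit_cell x))"
  by (simp add: torus_vol_def ennreal_indicator)

lemma emeasure_torus_vol_long_torus: "a > 0 \<Longrightarrow> emeasure (torus_vol (long_torus a)) UNIV = 1"
  by (simp add: torus_vol_long_torus emeasure_density ennreal_indicator)

lemma laplace_beltrami_long_torus:
  assumes "a > 0"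
  shows "laplace_beltrami (long_torus a) f x = pd 1 (\<lambda>z. 1 / a\<^sup>2 * pd 1 f z) x + pd 2 (\<lambda>z. a\<^sup>2 * pd 2 f z) x"
  using assms by (simp add: laplace_beltrami_def matrix_inv_long_torus sum_2)

lemma norm_differential_long_torus:
  assumes "a > 0"
  shows "norm_differential (long_torus a) f x = sqrt ((pd 1 f x / a)\<^sup>2 + (a * pd 2 f x)\<^sup>2)"
  using assms by (simp add: norm_differential_def matrix_inv_long_torus sum_2 power2_eq_square)

text \<open>The covector \<open>dx\<^sub>1\<close> has norm \<open>1 / a\<close>. Passing from the
  coordinate derivative to the intrinsic norm thus costs one factor \<open>a\<close> of the
  \<open>a\<^sup>2\<close> that the Green equation provides.\<close>

lemma abs_pd_le_norm_differential_long_torus: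
  assumes "a > 0"
  shows "\<bar>pd 1 f x\<bar> \<le> a * norm_differential (long_torus a) f x"
proof -
  have "\<bar>pd 1 f x / a\<bar> \<le> sqrt ((pd 1 f x / a)\<^sup>2 + (a * pd 2 f x)\<^sup>2)"
    by (rule real_sqrt_ge_abs1)
  then show ?thesis
    using assms by (simp add: norm_differential_long_torus field_simps)
qed

text \<open>The integrand is the derivative of a function periodic in the first coordinate. Its mean
  being zero removes the volume term when it is used as a test function in the Green
  equation.\<close>

lemma integral_unit_cell_cos:
  "(\<integral>x. indicator unit_cell x * cos (2 * pi * (x $ 1 - c)) \<partial>lborel) = 0"
proof (rule integral_unit_cell_derivative[where T = "{}" and i = 1
      and q = "\<lambda>x. sin (2 * pi * (x $ 1 - c)) / (2 * pi)"])
  have "integrable lborel (\<lambda>x. indicator unit_cell x *\<^sub>R cos (2 * pi * (x $ 1 - c)))"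
    by (rule Bochner_Integration.integrable_bound[where f = "indicator unit_cell :: _ \<Rightarrow> real"])
       (auto simp: indicator_def)
  then show "integrable lborel (\<lambda>x. indicator unit_cell x * cos (2 * pi * (x $ 1 - c)))"
    by simp
  show "((\<lambda>s. sin (2 * pi * (pt 1 s t $ 1 - c)) / (2 * pi)) has_real_derivative
      cos (2 * pi * (pt 1 s t $ 1 - c))) (at s)" for s t
    by (auto simp: pt_def intro!: derivative_eq_intros)
  show "isCont (\<lambda>s. cos (2 * pi * (pt 1 s t $ 1 - c))) s" for s t
    by (auto simp: pt_def intro!: continuous_intros)
  have "sin (2 * pi * (1 - c)) = sin (2 * pi * (0 - c))"
    using sin_periodic[of "2 * pi * (0 - c)"] by (simp add: algebra_simps)
  then show "sin (2 * pi * (pt 1 1 t $ 1 - c)) / (2 * pi) = sin (2 * pi * (pt 1 0 t $ 1 - c)) / (2 * pi)" for t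
    by (simp add: pt_def)
qed auto

text \<open>The cosine is an eigenfunction of the Laplacian with eigenvalue
  \<open>- (4 * pi\<^sup>2 / a\<^sup>2)\<close>, has mean zero and equals \<open>1\<close> at
  \<open>y\<close>. The Green equation therefore says that this eigenvalue times the integral is
  \<open>1\<close>.\<close>

lemma green_function_long_torus_cos:
  assumes a: "a > 0" and G: "green_function (long_torus a) G"
  shows "(\<integral>x. indicator unit_cell x * (G x y * cos (2 * pi * (x $ 1 - y $ 1))) \<partial>lborel)
    = - (a\<^sup>2 / (4 * pi\<^sup>2))"
proof -
  define c where "c = y $ 1"
  \<comment> \<open>Each differentiation multiplies by \<open>2 * pi\<close> and advances the phase
    by \<open>pi / 2\<close>, so all derivatives of the cosine have one closed form, as
    \<open>smooth_on_component\<close> requires.\<close>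
  define D where "D n t = (2 * pi) ^ n * cos (2 * pi * (t - c) + of_nat n * (pi / 2))" for n t
  define \<psi> where "\<psi> = (\<lambda>x::real^2. D 0 (x $ 1))"
  have \<psi>_eq: "\<psi> x = cos (2 * pi * (x $ 1 - c))" for x
    by (simp add: \<psi>_def D_def)
  have D: "(D n has_real_derivative D (Suc n) t) (at t)" for n t
  proof -
    have "cos (2 * pi * (t - c) + real (Suc n) * (pi / 2))
        = cos ((2 * pi * (t - c) + real n * (pi / 2)) + pi / 2)"
      by (simp add: algebra_simps add_divide_distrib)
    also have "\<dots> = - sin (2 * pi * (t - c) + real n * (pi / 2))"
      by (rule cos_add[THEN trans]) simp
    finally have "D (Suc n) t = (2 * pi) ^ n * (- sin (2 * pi * (t - c) + real n * (pi / 2)) * (2 * pi))"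
      unfolding D_def by (simp only: power_Suc mult_ac)
    then show ?thesis
      unfolding D_def[of n] by (auto intro!: derivative_eq_intros)
  qed
  have "smooth_on UNIV \<psi>"
    unfolding \<psi>_def by (rule smooth_on_component[where D = D]) (rule D)
  moreover have "torus_periodic \<psi>"
    unfolding torus_periodic_def
  proof (intro allI ballI)
    fix x n :: "real^2" assume "n \<in> int_lattice"
    then obtain m where m: "n $ 1 = of_int m" by (auto simp: int_lattice_def elim: Ints_cases)
    have "cos (2 * pi * (x $ 1 - c) + 2 * pi * of_int m) = cos (2 * pi * (x $ 1 - c))"
      by (simp add: cos_add sin_int_2pin cos_int_2pin)
    then show "\<psi> (x + n) = \<psi> x"
      by (simp add: \<psi>_eq m algebra_simps)
  qed
  moreover have lap: "laplace_beltrami (long_torus a) \<psi> x = - (4 * pi\<^sup>2 / a\<^sup>2) * cos (2 * pi * (x $ 1 - c))" for x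
  proof -
    have pd1: "pd i (\<lambda>x. k * D n (x $ 1)) x = k * (axis i 1 $ 1 * D (Suc n) (x $ 1))" for i k n x
      by (rule pd_eq[OF has_derivative_mult_right[OF has_derivative_component[OF D]]])
    have 1: "pd i \<psi> = (\<lambda>x. axis i 1 $ 1 * D 1 (x $ 1))" for i
      using pd1[of i 1 0] by (auto simp: \<psi>_def)
    have "laplace_beltrami (long_torus a) \<psi> x = 1 / a\<^sup>2 * D 2 (x $ 1)"
      using pd1[of 1 "1/a\<^sup>2" 1 x]
      by (simp add: laplace_beltrami_long_torus[OF a] 1 axis_def numeral_2_eq_2)
    also have "D 2 (x $ 1) = - (4 * pi\<^sup>2) * cos (2 * pi * (x $ 1 - c))"
      by (simp add: D_def power_mult_distrib)
    finally show ?thesis by simp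
  qed
  ultimately have green: "(LINT x|torus_vol (long_torus a). G x y * laplace_beltrami (long_torus a) \<psi> x) =
             \<psi> y - (LINT x|torus_vol (long_torus a). \<psi> x) / measure (torus_vol (long_torus a)) UNIV"
    using G unfolding green_function_def by blast
  have "integrable (torus_vol (long_torus a)) (\<lambda>x. G x y)"
    using G by (simp add: green_function_def)
  from borel_measurable_integrable[OF this]
  have [measurable]: "(\<lambda>x. G x y) \<in> borel_measurable borel"
    by (simp add: torus_vol_long_torus[OF a])
  have "(LINT x|torus_vol (long_torus a). \<psi> x) = 0"
    using integral_unit_cell_cos[of c]
    by (simp add: torus_vol_long_torus[OF a] \<psi>_eq integral_density)
  moreover have "\<psi> y = 1" by (simp add: \<psi>_eq c_def)
  moreover have "(LINT x|torus_vol (long_torus a). G x y * laplace_beltrami (long_torus a) \<psi> x)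
     = - (4 * pi\<^sup>2 / a\<^sup>2) * (\<integral>x. indicator unit_cell x * (G x y * cos (2 * pi * (x $ 1 - c))) \<partial>lborel)"
  proof -
    have "(LINT x|torus_vol (long_torus a). G x y * laplace_beltrami (long_torus a) \<psi> x)
      = (\<integral>x. indicator unit_cell x *\<^sub>R (G x y * (- (4 * pi\<^sup>2 / a\<^sup>2) * cos (2 * pi * (x $ 1 - c)))) \<partial>lborel)"
      unfolding lap torus_vol_long_torus[OF a] by (rule integral_density) auto
    also have "\<dots> = (\<integral>x. - (4 * pi\<^sup>2 / a\<^sup>2) * (indicator unit_cell x * (G x y * cos (2 * pi * (x $ 1 - c)))) \<partial>lborel)"
      by (intro Bochner_Integration.integral_cong) auto
    also have "\<dots> = - (4 * pi\<^sup>2 / a\<^sup>2) * (\<integral>x. indicator unit_cell x * (G x y * cos (2 * pi * (x $ 1 - c))) \<partial>lborel)"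
      by (rule integral_mult_right_zero)
    finally show ?thesis .
  qed
  ultimately have "- (4 * pi\<^sup>2 / a\<^sup>2) * (\<integral>x. indicator unit_cell x * (G x y * cos (2 * pi * (x $ 1 - c))) \<partial>lborel) = 1"
    using green by simp
  then show ?thesis using a unfolding c_def by (simp add: field_simps)
qed

section \<open>The gradient bound\<close>

lemma open_off_lattice: "open {x. x - y \<notin> int_lattice}"
proof -
  have "{x. x - y \<notin> int_lattice} = (\<Union>i. {x. x $ i - y $ i \<in> - \<int>})"
    by (auto simp: int_lattice_def)
  moreover have "open {x::real^2. x $ i - y $ i \<in> - \<int>}" for i
    using open_vimage[of "- \<int> :: real set" "\<lambda>x. x $ i - y $ i"]
    by (simp add: vimage_def open_Compl continuous_intros)
  ultimately show ?thesis by auto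
qed

text \<open>When the supremum is finite, the proof establishes that
  \<open>a\<^sup>2 / (2 * pi)\<close> is the integral of \<open>p * \<eta>\<close>, hence at most
  that of \<open>\<bar>p\<bar>\<close>, hence at most \<open>a\<close> times that of
  \<open>N\<close>. One factor \<open>a\<close> cancels, and the dyadic estimate bounds the integral
  of \<open>N\<close> by the right-hand side.\<close>

lemma green_gradient_lower_bound:
  assumes a: "a > 0" and G: "green_function (long_torus a) G"
  shows "ennreal (a / (2 * pi)) \<le> 1 + 2 * (SUP t\<in>{0<..}. ennreal (t^2) *
    emeasure (torus_vol (long_torus a))
      {x. x - y \<notin> int_lattice \<and> norm_differential (long_torus a) (\<lambda>z. G z y) x \<ge> t})"
    (is "_ \<le> 1 + 2 * ?C")
proof (cases "?C = \<infinity>")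
  case False
  define u where "u = (\<lambda>z. G z y)"
  define S where "S = {x. x - y \<notin> int_lattice}"
  \<comment> \<open>\<open>p\<close> and \<open>N\<close> are set to \<open>0\<close> at the lattice
    translates of the pole, which makes them Borel on the whole plane. The superlevel sets of
    \<open>N\<close> with \<open>t > 0\<close> are those of the statement.\<close>
  define p where "p x = (if x \<in> S then pd 1 u x else 0)" for x
  define N where "N x = (if x \<in> S then norm_differential (long_torus a) u x else 0)" for x
  define \<eta> where "\<eta> x = sin (2 * pi * (x $ 1 - y $ 1))" for x :: "real^2"
  define \<psi> where "\<psi> x = cos (2 * pi * (x $ 1 - y $ 1))" for x :: "real^2"
  define M where "M = torus_vol (long_torus a)"
  have M: "M = density lborel (\<lambda>x. ennreal (indicator unit_cell x))"
    by (simp add: M_def torus_vol_long_torus[OF a])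
  have [measurable_cong]: "sets M = sets borel" by (simp add: M)
  have spM: "space M = UNIV" by (simp add: M)
  have uM: "integrable M u" and sm: "smooth_on S u" and per: "torus_periodic u"
    using G by (auto simp: green_function_def M_def u_def S_def)
  have oS: "open S" unfolding S_def by (rule open_off_lattice)
  have diff: "u differentiable (at x)" "isCont (pd i u) x" if "x \<in> S" for x i
    using smooth_onD[OF sm that] differentiable_imp_continuous_within by blast+
  have cont: "continuous_on S (pd i u)" for i
    using diff by (intro continuous_at_imp_continuous_on) auto
  have [measurable]: "S \<in> sets borel" using oS by auto
  have p[measurable]: "p \<in> borel_measurable borel"
    unfolding p_def by (intro borel_measurable_continuous_on_if cont) auto
  have N[measurable]: "N \<in> borel_measurable borel"
    unfolding N_def norm_differential_long_torus[OF a]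
    by (intro borel_measurable_continuous_on_if continuous_intros cont) (use a in auto)
  have [measurable]: "\<eta> \<in> borel_measurable borel" "\<psi> \<in> borel_measurable borel"
    unfolding \<eta>_def \<psi>_def by measurable
  have [measurable]: "u \<in> borel_measurable borel"
    using borel_measurable_integrable[OF uM] by (simp add: M)
  have set_eq: "{x \<in> space M. t \<le> N x}
      = {x. x - y \<notin> int_lattice \<and> norm_differential (long_torus a) (\<lambda>z. G z y) x \<ge> t}" if "t > 0" for t
    using that by (auto simp: N_def S_def spM u_def split: if_splits)
  have "(\<integral>\<^sup>+x. ennreal (N x) \<partial>M)
      \<le> 1 + 2 * (SUP t\<in>{0<..}. ennreal (t^2) * emeasure M {x\<in>space M. t \<le> N x})"
    using emeasure_torus_vol_long_torus[OF a]
    by (intro nn_integral_le_weak_L2) (auto simp: M_def[symmetric] spM)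
  also have "(SUP t\<in>{0<..}. ennreal (t^2) * emeasure M {x\<in>space M. t \<le> N x}) = ?C"
    by (intro SUP_cong) (auto simp: set_eq M_def[symmetric])
  finally have NC: "(\<integral>\<^sup>+x. ennreal (N x) \<partial>M) \<le> 1 + 2 * ?C" .
  have "1 + 2 * c < top" if "c \<noteq> \<infinity>" for c :: ennreal
  proof -
    obtain r where "c = ennreal r" "r \<ge> 0" using \<open>c \<noteq> \<infinity>\<close> by (cases c) auto
    then have "1 + 2 * c = ennreal (1 + 2 * r)" by (simp add: ennreal_mult)
    then show ?thesis by simp
  qed
  from this[OF False] have "1 + 2 * ?C < top" .
  then obtain K where K: "1 + 2 * ?C = ennreal K" "K \<ge> 0"
    by (cases "1 + 2 * ?C") auto
  have pN: "\<bar>p x\<bar> \<le> a * N x" for x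
    using abs_pd_le_norm_differential_long_torus[OF a] by (auto simp: p_def N_def)
  have pK: "(\<integral>\<^sup>+x. ennreal \<bar>p x\<bar> \<partial>M) \<le> ennreal (a * K)"
  proof -
    have "(\<integral>\<^sup>+x. ennreal \<bar>p x\<bar> \<partial>M) \<le> (\<integral>\<^sup>+x. ennreal a * ennreal (N x) \<partial>M)"
      using a pN by (intro nn_integral_mono) (auto simp: ennreal_mult'[symmetric] intro!: ennreal_leI)
    also have "\<dots> = ennreal a * (\<integral>\<^sup>+x. ennreal (N x) \<partial>M)"
      by (intro nn_integral_cmult) measurable
    also have "\<dots> \<le> ennreal a * ennreal K"
      using NC by (intro mult_left_mono) (auto simp: K)
    finally show ?thesis using a K by (simp add: ennreal_mult)
  qed
  \<comment> \<open>Finiteness of the supremum enters here: it makes the derivative integrable up to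
    the pole, as Fubini requires.\<close>
  have pM: "integrable M p"
    using pK by (intro integrableI_bounded) (auto simp: top.extremum_strict intro: le_less_trans)
  have p\<eta>M: "integrable M (\<lambda>x. p x * \<eta> x)"
    by (rule Bochner_Integration.integrable_bound[OF pM])
      (auto simp: \<eta>_def abs_mult intro!: mult_left_le)
  have u\<psi>M: "integrable M (\<lambda>x. u x * \<psi> x)"
    by (rule Bochner_Integration.integrable_bound[OF uM])
      (auto simp: \<psi>_def abs_mult intro!: mult_left_le)
  \<comment> \<open>Away from the pole this is the derivative of \<open>u * \<eta>\<close> in the
    first coordinate.\<close>
  define w where "w x = p x * \<eta> x + 2 * pi * (u x * \<psi> x)" for x
  have wM: "integrable M w"
    unfolding w_def using p\<eta>M u\<psi>M by auto
  have [measurable]: "w \<in> borel_measurable borel" unfolding w_def by measurable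
  \<comment> \<open>These are the heights of the horizontal lines through lattice translates of
    \<open>y\<close>; all other horizontal lines stay inside \<open>S\<close>.\<close>
  define T where "T = {t. t - y $ 2 \<in> \<int>}"
  have "(\<integral>x. indicator unit_cell x * w x \<partial>lborel) = 0"
  proof (rule integral_unit_cell_derivative[where T = T and i = 1 and q = "\<lambda>x. u x * \<eta> x"])
    show "integrable lborel (\<lambda>x. indicator unit_cell x * w x)"
      using wM by (simp add: M integrable_density)
    have "T = (\<lambda>n. n + y $ 2) ` \<int>" by (force simp: T_def)
    then show "countable T" by (simp add: countable_int)
    fix t assume t: "t \<notin> T"
    have inS: "pt 1 s t \<in> S" for s
      using t by (auto simp: S_def T_def int_lattice_def pt_def intro!: exI[of _ "2::2"])
    show "u (pt 1 1 t) * \<eta> (pt 1 1 t) = u (pt 1 0 t) * \<eta> (pt 1 0 t)"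
    proof -
      have "sin (2 * pi * (1 - y $ 1)) = sin (2 * pi * (0 - y $ 1))"
        using sin_periodic[of "2 * pi * (0 - y $ 1)"] by (simp add: algebra_simps)
      moreover have "u (pt 1 1 t) = u (pt 1 0 t)"
        using per pt_add_axis[of 1 0 t] by (simp add: torus_periodic_def)
      ultimately show ?thesis by (simp add: \<eta>_def pt_def)
    qed
    fix s
    have "((\<lambda>s. sin (2 * pi * (s - y $ 1))) has_real_derivative 2 * pi * cos (2 * pi * (s - y $ 1))) (at s)"
      by (auto intro!: derivative_eq_intros)
    from DERIV_mult[OF has_real_derivative_pt[OF diff(1)[OF inS]] this]
    show "((\<lambda>s. u (pt 1 s t) * \<eta> (pt 1 s t)) has_real_derivative w (pt 1 s t)) (at s)"
      using inS by (simp add: \<eta>_def w_def \<psi>_def p_def pt_def[of 1] algebra_simps)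
    have ptc: "isCont (\<lambda>s. pt 1 s t) s"
      using continuous_on_pt[of UNIV "\<lambda>s. s" "\<lambda>_. t" 1] by (auto simp: continuous_on_eq_continuous_at)
    have "isCont (\<lambda>s. pd 1 u (pt 1 s t)) s" "isCont (\<lambda>s. u (pt 1 s t)) s"
      using isCont_o2[OF ptc diff(2)[OF inS]]
        isCont_o2[OF ptc differentiable_imp_continuous_within[OF diff(1)[OF inS]]] by auto
    then show "isCont (\<lambda>s. w (pt 1 s t)) s"
      using inS by (auto simp: w_def p_def \<eta>_def \<psi>_def pt_def[of 1] intro!: continuous_intros)
  qed
  then have "integral\<^sup>L M w = 0"
    by (simp add: M integral_density)
  then have "integral\<^sup>L M (\<lambda>x. p x * \<eta> x) = - (2 * pi) * integral\<^sup>L M (\<lambda>x. u x * \<psi> x)"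
    unfolding w_def using p\<eta>M u\<psi>M by simp
  also have "integral\<^sup>L M (\<lambda>x. u x * \<psi> x) = - (a\<^sup>2 / (4 * pi\<^sup>2))"
  proof -
    have "integral\<^sup>L M (\<lambda>x. u x * \<psi> x) = (\<integral>x. indicator unit_cell x *\<^sub>R (u x * \<psi> x) \<partial>lborel)"
      unfolding M by (rule integral_density) auto
    then show ?thesis
      using green_function_long_torus_cos[OF a G, of y] by (simp add: u_def \<psi>_def)
  qed
  finally have "a\<^sup>2 / (2 * pi) = integral\<^sup>L M (\<lambda>x. p x * \<eta> x)"
    by (simp add: power2_eq_square field_simps)
  then have "ennreal (a\<^sup>2 / (2 * pi)) \<le> ennreal (norm (integral\<^sup>L M (\<lambda>x. p x * \<eta> x)))"
    by (intro ennreal_leI) auto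
  also have "\<dots> \<le> (\<integral>\<^sup>+x. norm (p x * \<eta> x) \<partial>M)"
    by (rule integral_norm_bound_ennreal[OF p\<eta>M])
  also have "\<dots> \<le> (\<integral>\<^sup>+x. ennreal \<bar>p x\<bar> \<partial>M)"
    by (intro nn_integral_mono ennreal_leI) (auto simp: \<eta>_def abs_mult intro!: mult_left_le)
  also have "\<dots> \<le> ennreal (a * K)" by (rule pK)
  finally have "a\<^sup>2 / (2 * pi) \<le> a * K"
    using a K by (subst (asm) ennreal_le_iff) auto
  then have "a / (2 * pi) \<le> K"
    using a by (simp add: power2_eq_square field_simps)
  then show ?thesis by (simp add: K ennreal_leI)
next
  case True
  then have eq: "?C = top" by (simp only: infinity_ennreal_def)
  show ?thesis unfolding eq by (simp add: ennreal_mult_top)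
qed

subsection \<open>The minimal energy of essential circle maps\<close>

lemma torus_metric_sym:
  assumes "torus_metric g"
  shows "g x $ 2 $ 1 = g x $ 1 $ 2"
proof -
  have "transpose (g x) = g x" using assms by (simp add: torus_metric_def)
  then have "transpose (g x) $ 1 $ 2 = g x $ 1 $ 2" by simp
  then show ?thesis by (simp add: transpose_def)
qed

lemma torus_metric_quadratic_form:
  assumes "torus_metric g" "p \<noteq> 0 \<or> q \<noteq> 0"
  shows "g x $ 1 $ 1 * p\<^sup>2 + 2 * g x $ 1 $ 2 * p * q + g x $ 2 $ 2 * q\<^sup>2 > 0"
proof -
  have "(vector [p, q] :: real^2) \<noteq> 0"
    using assms(2) by (auto simp: vec_eq_iff forall_2)
  then have "0 < (vector [p, q] :: real^2) \<bullet> (g x *v vector [p, q])"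
    using assms(1) by (simp add: torus_metric_def)
  also have "\<dots> = g x $ 1 $ 1 * p\<^sup>2 + 2 * g x $ 1 $ 2 * p * q + g x $ 2 $ 2 * q\<^sup>2"
    by (simp add: inner_vec_def matrix_vector_mult_def sum_2 torus_metric_sym[OF assms(1)]
        power2_eq_square algebra_simps)
  finally show ?thesis .
qed

lemma torus_metric_diag_pos: "torus_metric g \<Longrightarrow> g x $ 1 $ 1 > 0" "torus_metric g \<Longrightarrow> g x $ 2 $ 2 > 0"
  using torus_metric_quadratic_form[of g 1 0 x] torus_metric_quadratic_form[of g 0 1 x] by auto

text \<open>The quadratic form of \<open>g\<close> at the vector with entries
  \<open>- g x $ 1 $ 2\<close> and \<open>g x $ 1 $ 1\<close> equals
  \<open>g x $ 1 $ 1 * det (g x)\<close>.\<close>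

lemma torus_metric_det_pos:
  assumes g: "torus_metric g"
  shows "det (g x) > 0"
proof -
  have "g x $ 1 $ 1 * det (g x) > 0"
    using torus_metric_quadratic_form[OF g, of "- g x $ 1 $ 2" "g x $ 1 $ 1" x] torus_metric_diag_pos[OF g, of x]
    by (simp add: det_2 torus_metric_sym[OF g] power2_eq_square algebra_simps)
  then show ?thesis
    using torus_metric_diag_pos[OF g, of x] by (simp add: zero_less_mult_iff)
qed

lemma continuous_on_differentiable:
  "(\<And>x. f differentiable (at x)) \<Longrightarrow> continuous_on S f"
  by (meson continuous_at_imp_continuous_on differentiable_imp_continuous_within)

lemma torus_metric_continuous: "torus_metric g \<Longrightarrow> continuous_on S (\<lambda>x. g x $ i $ j)"
  by (rule continuous_on_differentiable, rule smooth_onD(1)[of UNIV])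
    (simp_all add: torus_metric_def)

lemma torus_metric_periodic: "torus_metric g \<Longrightarrow> n \<in> int_lattice \<Longrightarrow> g (x + n) = g x"
  by (simp add: torus_metric_def torus_periodic_def)

text \<open>This is \<open>|df|\<^sup>2 sqrt (det g)\<close>, the density of the Dirichlet energy with respect to Lebesgue
  measure, with the inverse of the \<open>2\<close>-by-\<open>2\<close> matrix \<open>g\<close> written out.\<close>

definition energy_density :: "(real^2 \<Rightarrow> real^2^2) \<Rightarrow> (real^2 \<Rightarrow> real) \<Rightarrow> real^2 \<Rightarrow> real" where
  "energy_density g f x =
     (g x $ 2 $ 2 * (pd 1 f x)\<^sup>2 - 2 * g x $ 1 $ 2 * pd 1 f x * pd 2 f x + g x $ 1 $ 1 * (pd 2 f x)\<^sup>2)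
       / sqrt (det (g x))"

definition energy :: "(real^2 \<Rightarrow> real^2^2) \<Rightarrow> (real^2 \<Rightarrow> real) \<Rightarrow> ennreal" where
  "energy g f = (\<integral>\<^sup>+x. ennreal (energy_density g f x) * indicator unit_cell x \<partial>lborel)"

text \<open>Lifts of \<open>C\<^sup>1\<close> maps from the torus to the circle \<open>\<real>/\<int>\<close> that are not homotopic to a
  constant.\<close>

definition essential_circle_map :: "(real^2 \<Rightarrow> real) \<Rightarrow> bool" where
  "essential_circle_map f \<longleftrightarrow>
     (\<forall>x. f differentiable (at x)) \<and> (\<forall>i. continuous_on UNIV (pd i f)) \<and>
     (\<forall>x. \<forall>n\<in>int_lattice. f (x + n) - f x \<in> \<int>) \<and> \<not> torus_periodic f"

section \<open>Positivity of the least energy\<close>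

text \<open>The eigenvalues of the form on the right have product \<open>a * c - b\<^sup>2\<close>
  and positive sum \<open>a + c\<close>, and the smaller one is at least the quotient. Multiplied by
  \<open>a + c\<close>, the difference of the two sides is a sum of two squares.\<close>

lemma tr_form_ge_det:
  fixes a b c p q :: real
  assumes "a > 0" "c > 0"
  shows "(a * c - b\<^sup>2) / (a + c) * (p\<^sup>2 + q\<^sup>2) \<le> c * p\<^sup>2 - 2 * b * p * q + a * q\<^sup>2"
proof -
  have "(a + c) * (c * p\<^sup>2 - 2 * b * p * q + a * q\<^sup>2) - (a * c - b\<^sup>2) * (p\<^sup>2 + q\<^sup>2)
      = (c * p - b * q)\<^sup>2 + (b * p - a * q)\<^sup>2"
    by (simp add: power2_eq_square algebra_simps)
  then have "(a * c - b\<^sup>2) * (p\<^sup>2 + q\<^sup>2) \<le> (a + c) * (c * p\<^sup>2 - 2 * b * p * q + a * q\<^sup>2)"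
    using sum_power2_ge_zero[of "c * p - b * q" "b * p - a * q"] by linarith
  then show ?thesis using assms by (simp add: field_simps)
qed

lemma energy_density_nonneg:
  assumes g: "torus_metric g"
  shows "0 \<le> energy_density g f x"
  unfolding energy_density_def
proof (rule divide_nonneg_nonneg)
  show "0 \<le> g x $ 2 $ 2 * (pd 1 f x)\<^sup>2 - 2 * g x $ 1 $ 2 * pd 1 f x * pd 2 f x
      + g x $ 1 $ 1 * (pd 2 f x)\<^sup>2"
  proof (cases "pd 1 f x = 0 \<and> pd 2 f x = 0")
    case False
    \<comment> \<open>The numerator is the form of the adjugate of \<open>g x\<close>, which is the
      form of \<open>g x\<close> itself at the gradient rotated by a right angle.\<close>
    then have "- pd 2 f x \<noteq> 0 \<or> pd 1 f x \<noteq> 0" by auto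
    from torus_metric_quadratic_form[OF g this, of x] show ?thesis
      by (simp add: algebra_simps)
  qed simp
qed (simp add: torus_metric_det_pos[OF g] less_imp_le)

text \<open>Determinant over trace bounds the numerator by \<open>tr_form_ge_det\<close>; division
  by \<open>sqrt (det (g x))\<close> leaves the function \<open>r\<close> of the proof. It is
  continuous, periodic and positive, so its minimum serves as a constant independent of
  \<open>f\<close>.\<close>

lemma energy_density_ge:
  assumes g: "torus_metric g"
  obtains c where "c > 0" "\<And>f x. c * ((pd 1 f x)\<^sup>2 + (pd 2 f x)\<^sup>2) \<le> energy_density g f x"
proof -
  define r where "r x = sqrt (det (g x)) / (g x $ 1 $ 1 + g x $ 2 $ 2)" for x
  have pos: "g x $ 1 $ 1 > 0" "g x $ 2 $ 2 > 0" "det (g x) > 0" for x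
    using torus_metric_diag_pos[OF g] torus_metric_det_pos[OF g] by auto
  have "torus_periodic r"
    using torus_metric_periodic[OF g] by (simp add: torus_periodic_def r_def)
  moreover have "continuous_on UNIV r"
    unfolding r_def det_2
    by (intro continuous_intros torus_metric_continuous[OF g] ballI less_imp_neq[THEN not_sym] add_pos_pos pos)
  ultimately obtain z where z: "r z \<le> r x" for x
    using torus_periodic_attains_inf by blast
  have "r z > 0" using pos[of z] by (auto simp: r_def intro!: divide_pos_pos)
  moreover have "r z * ((pd 1 f x)\<^sup>2 + (pd 2 f x)\<^sup>2) \<le> energy_density g f x" for f x
  proof -
    define D where "D = sqrt (det (g x))"
    have D: "D > 0" using pos[of x] by (simp add: D_def)
    have d: "g x $ 1 $ 1 * g x $ 2 $ 2 - (g x $ 1 $ 2)\<^sup>2 = D * D"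
      unfolding D_def using pos[of x] by (simp add: det_2 torus_metric_sym[OF g] power2_eq_square)
    have "r z * ((pd 1 f x)\<^sup>2 + (pd 2 f x)\<^sup>2) \<le> r x * ((pd 1 f x)\<^sup>2 + (pd 2 f x)\<^sup>2)"
      by (intro mult_right_mono z) simp
    also have "\<dots> = (g x $ 1 $ 1 * g x $ 2 $ 2 - (g x $ 1 $ 2)\<^sup>2) / (g x $ 1 $ 1 + g x $ 2 $ 2)
        * ((pd 1 f x)\<^sup>2 + (pd 2 f x)\<^sup>2) / sqrt (det (g x))"
      unfolding d r_def D_def[symmetric] using D by simp
    also have "\<dots> \<le> energy_density g f x"
      unfolding energy_density_def
      by (intro divide_right_mono tr_form_ge_det pos) (use pos[of x] in simp)
    finally show ?thesis .
  qed
  ultimately show ?thesis using that by blast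
qed

text \<open>The difference of the two values is a continuous integer-valued function on a connected
  space.\<close>

lemma essential_circle_map_lattice_shift:
  assumes f: "essential_circle_map f" and n: "n \<in> int_lattice"
  shows "\<exists>k\<in>\<int>. \<forall>x. f (x + n) = f x + k"
proof -
  have contf: "continuous_on UNIV f"
    using f by (intro continuous_on_differentiable) (simp add: essential_circle_map_def)
  define d where "d x = f (x + n) - f x" for x
  have dZ: "d x \<in> \<int>" for x
    using f n by (simp add: essential_circle_map_def d_def)
  have "d constant_on UNIV"
  proof (rule continuous_discrete_range_constant)
    show "continuous_on UNIV d"
      unfolding d_def by (intro continuous_intros continuous_on_compose2[OF contf]) auto
    fix x
    have "1 \<le> norm (d y - d x)" if "d y \<noteq> d x" for y
      using Ints_nonzero_abs_ge1[of "d y - d x"] dZ that by auto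
    then show "\<exists>e>0. \<forall>y. y \<in> UNIV \<and> d y \<noteq> d x \<longrightarrow> e \<le> norm (d y - d x)"
      by (intro exI[of _ 1]) auto
  qed (simp add: convex_connected)
  then obtain k where k: "d x = k" for x by (auto simp: constant_on_def)
  have "f (x + n) = f x + k" for x
    using k[of x] by (simp add: d_def)
  moreover have "k \<in> \<int>" using dZ k by metis
  ultimately show ?thesis by blast
qed

text \<open>If both generators of the lattice had period \<open>0\<close>, iterating the shifts
  would make \<open>f\<close> periodic.\<close>

lemma essential_circle_map_shift:
  assumes f: "essential_circle_map f"
  obtains i k where "k \<in> \<int>" "k \<noteq> 0" "\<And>x. f (x + axis i 1) = f x + k"
proof -
  have "\<exists>k\<in>\<int>. \<forall>x. f (x + axis i 1) = f x + k" for i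
    using essential_circle_map_lattice_shift[OF f] by simp
  then obtain k where k: "k i \<in> \<int>" "f (x + axis i 1) = f x + k i" for i x
    by metis
  have "\<exists>i. k i \<noteq> 0"
  proof (rule ccontr)
    assume "\<not> ?thesis"
    then have step: "f (x + axis i 1) = f x" for i x using k by simp
    have iter: "f (x + of_int m *\<^sub>R axis i 1) = f x" for m i x
    proof (induction m rule: int_induct[where k = 0])
      case (step1 m)
      then show ?case using step[of "x + of_int m *\<^sub>R axis i 1" i]
        by (simp add: scaleR_add_left add.assoc)
    next
      case (step2 m)
      then show ?case using step[of "x + of_int (m - 1) *\<^sub>R axis i 1" i]
        by (simp add: scaleR_diff_left algebra_simps)
    qed simp
    have "torus_periodic f"
      unfolding torus_periodic_def int_lattice_eq by (auto simp: add.assoc[symmetric] iter)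
    then show False using f by (simp add: essential_circle_map_def)
  qed
  then show ?thesis using k that by blast
qed

text \<open>On every line of direction \<open>i\<close> the map gains the nonzero integer
  \<open>k\<close> over a unit interval, so the squared derivative integrates to at least
  \<open>k\<^sup>2\<close> by Cauchy-Schwarz. Integrating over the parallel lines gives the
  bound.\<close>

lemma essential_circle_map_gradient_ge:
  assumes f: "essential_circle_map f"
  shows "1 \<le> (\<integral>\<^sup>+x. ennreal ((pd 1 f x)\<^sup>2 + (pd 2 f x)\<^sup>2) * indicator unit_cell x \<partial>lborel)"
proof -
  obtain i k where k: "k \<in> \<int>" "k \<noteq> 0" "\<And>x. f (x + axis i 1) = f x + k"
    by (rule essential_circle_map_shift[OF f]) blast
  have diff: "f differentiable (at x)" and cont: "continuous_on UNIV (pd j f)" for x j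
    using f by (auto simp: essential_circle_map_def)
  have [measurable]: "pd j f \<in> borel_measurable borel" for j
    by (rule borel_measurable_continuous_onI[OF cont])
  have k1: "1 \<le> k\<^sup>2"
    using Ints_nonzero_abs_ge1[OF k(1,2)] by (metis one_power2 abs_le_square_iff abs_one)
  have line: "1 \<le> (\<integral>\<^sup>+s. ennreal ((pd i f (pt i s t))\<^sup>2) * indicator {0..<1} s \<partial>lborel)" for t
  proof -
    define p where "p s = pd i f (pt i s t)" for s
    have "continuous_on UNIV p"
      unfolding p_def by (intro continuous_on_compose2[OF cont] continuous_intros) auto
    then have pc: "isCont p s" for s by (simp add: continuous_on_eq_continuous_at)
    \<comment> \<open>Cauchy-Schwarz is used as
      \<open>2 * k * p s - k\<^sup>2 \<le> (p s)\<^sup>2\<close>, whose left side has the explicit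
      antiderivative given here.\<close>
    have der: "((\<lambda>s. 2 * k * f (pt i s t) - k\<^sup>2 * s) has_real_derivative 2 * k * p s - k\<^sup>2) (at s)" for s
      unfolding p_def by (auto intro!: derivative_eq_intros has_real_derivative_pt[OF diff])
    have "has_bochner_integral lborel (\<lambda>s. (2 * k * p s - k\<^sup>2) * indicator {0..1} s)
        ((2 * k * f (pt i 1 t) - k\<^sup>2 * 1) - (2 * k * f (pt i 0 t) - k\<^sup>2 * 0))"
      by (intro has_bochner_integral_FTC_Icc_real der continuous_intros pc) simp
    also have "(2 * k * f (pt i 1 t) - k\<^sup>2 * 1) - (2 * k * f (pt i 0 t) - k\<^sup>2 * 0) = k\<^sup>2"
    proof -
      have "f (pt i 1 t) = f (pt i 0 t) + k"
        using pt_add_axis[of i 0 t] k(3) by simp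
      then show ?thesis by (simp add: power2_eq_square algebra_simps)
    qed
    finally have hb: "has_bochner_integral lborel (\<lambda>s. (2 * k * p s - k\<^sup>2) * indicator {0..1} s) (k\<^sup>2)" .
    have ip: "integrable lborel (\<lambda>s. (p s)\<^sup>2 * indicator {0..1} s)"
      by (intro borel_integrable_atLeastAtMost continuous_intros pc)
    have "k\<^sup>2 = (\<integral>s. (2 * k * p s - k\<^sup>2) * indicator {0..1} s \<partial>lborel)"
      using hb by (simp add: has_bochner_integral_integral_eq)
    also have "\<dots> \<le> (\<integral>s. (p s)\<^sup>2 * indicator {0..1} s \<partial>lborel)"
    proof (rule integral_mono[OF _ ip])
      show "integrable lborel (\<lambda>s. (2 * k * p s - k\<^sup>2) * indicator {0..1} s)"
        using hb by (simp add: has_bochner_integral_iff)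
      have "2 * k * p s - k\<^sup>2 \<le> (p s)\<^sup>2" for s
        using zero_le_power2[of "p s - k"] by (simp add: power2_eq_square algebra_simps)
      then show "(2 * k * p s - k\<^sup>2) * indicator {0..1} s \<le> (p s)\<^sup>2 * indicator {0..1} s" for s
        by (intro mult_right_mono) auto
    qed
    finally have "1 \<le> (\<integral>s. (p s)\<^sup>2 * indicator {0..1} s \<partial>lborel)"
      using k1 by simp
    then have "1 \<le> ennreal (\<integral>s. (p s)\<^sup>2 * indicator {0..1} s \<partial>lborel)"
      by simp
    also have "\<dots> = (\<integral>\<^sup>+s. ennreal ((p s)\<^sup>2 * indicator {0..1} s) \<partial>lborel)"
      by (intro nn_integral_eq_integral[symmetric] ip) auto
    also have "\<dots> = (\<integral>\<^sup>+s. ennreal ((p s)\<^sup>2) * indicator {0..<1} s \<partial>lborel)"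
    proof (rule nn_integral_cong_AE)
      show "AE s in lborel. ennreal ((p s)\<^sup>2 * indicator {0..1} s) = ennreal ((p s)\<^sup>2) * indicator {0..<1} s"
        using AE_lborel_singleton[of "1::real"] by eventually_elim (auto simp: indicator_def)
    qed
    finally show ?thesis by (simp add: p_def)
  qed
  have "1 = (\<integral>\<^sup>+t. 1 * indicator {0..<1::real} t \<partial>lborel)"
    by simp
  also have "\<dots> \<le> (\<integral>\<^sup>+t. (\<integral>\<^sup>+s. ennreal ((pd i f (pt i s t))\<^sup>2) * indicator {0..<1} s \<partial>lborel)
      * indicator {0..<1} t \<partial>lborel)"
    by (intro nn_integral_mono mult_right_mono line) simp
  also have "\<dots> = (\<integral>\<^sup>+t. \<integral>\<^sup>+s. ennreal ((pd i f (pt i s t))\<^sup>2) * indicator unit_cell (pt i s t) \<partial>lborel \<partial>lborel)"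
  proof (rule nn_integral_cong)
    fix t
    have [measurable]: "(\<lambda>s. pd i f (pt i s t)) \<in> borel_measurable borel"
      by (intro borel_measurable_continuous_onI continuous_on_compose2[OF cont] continuous_intros) auto
    show "(\<integral>\<^sup>+s. ennreal ((pd i f (pt i s t))\<^sup>2) * indicator {0..<1} s \<partial>lborel) * indicator {0..<1} t
      = (\<integral>\<^sup>+s. ennreal ((pd i f (pt i s t))\<^sup>2) * indicator unit_cell (pt i s t) \<partial>lborel)"
      by (subst nn_integral_multc[symmetric]) (auto simp: indicator_unit_cell_pt mult.assoc)
  qed
  also have "\<dots> = (\<integral>\<^sup>+x. ennreal ((pd i f x)\<^sup>2) * indicator unit_cell x \<partial>lborel)"
    by (rule nn_integral_lborel_pt[symmetric]) measurable
  also have "\<dots> \<le> (\<integral>\<^sup>+x. ennreal ((pd 1 f x)\<^sup>2 + (pd 2 f x)\<^sup>2) * indicator unit_cell x \<partial>lborel)"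
    using exhaust_2[of i] by (intro nn_integral_mono mult_right_mono ennreal_leI) auto
  finally show ?thesis .
qed

text \<open>\<open>c\<close> depends on the metric but not on the map, so the least energy of each
  single metric is positive.\<close>

lemma energy_lower_bound:
  assumes g: "torus_metric g"
  obtains c where "c > 0" "\<And>f. essential_circle_map f \<Longrightarrow> ennreal c \<le> energy g f"
proof -
  obtain c where c: "c > 0" "\<And>f x. c * ((pd 1 f x)\<^sup>2 + (pd 2 f x)\<^sup>2) \<le> energy_density g f x"
    using energy_density_ge[OF g] by blast
  have "ennreal c \<le> energy g f" if f: "essential_circle_map f" for f
  proof -
    have [measurable]: "pd j f \<in> borel_measurable borel" for j
      using f by (intro borel_measurable_continuous_onI) (simp add: essential_circle_map_def)
    have "ennreal c * 1
        \<le> ennreal c * (\<integral>\<^sup>+x. ennreal ((pd 1 f x)\<^sup>2 + (pd 2 f x)\<^sup>2) * indicator unit_cell x \<partial>lborel)"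
      by (intro mult_left_mono essential_circle_map_gradient_ge f) simp
    also have "\<dots> = (\<integral>\<^sup>+x. ennreal c * (ennreal ((pd 1 f x)\<^sup>2 + (pd 2 f x)\<^sup>2) * indicator unit_cell x) \<partial>lborel)"
      by (rule nn_integral_cmult[symmetric]) measurable
    also have "\<dots> \<le> energy g f"
    proof -
      have "ennreal c * ennreal ((pd 1 f x)\<^sup>2 + (pd 2 f x)\<^sup>2) \<le> ennreal (energy_density g f x)" for x
        using c by (subst ennreal_mult'[symmetric]) (auto intro!: ennreal_leI)
      then show ?thesis
        unfolding energy_def mult.assoc[symmetric] by (intro nn_integral_mono mult_right_mono) auto
    qed
    finally show ?thesis by simp
  qed
  then show ?thesis using that c(1) by blast
qed

section \<open>Diffeomorphisms and conformal invariance of the energy\<close>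

lemma smooth_map_derivative:
  fixes F :: "real^2 \<Rightarrow> real^2"
  assumes F: "\<And>i. smooth_on UNIV (\<lambda>x. F x $ i)"
  shows "(F has_derivative (\<lambda>v. jacobian F (at x) *v v)) (at x)"
    and "jacobian F (at x) $ k $ i = pd i (\<lambda>x. F x $ k) x"
proof -
  have "F differentiable (at x)"
    unfolding differentiable_componentwise_within[of F x UNIV]
  proof
    fix b :: "real^2" assume "b \<in> Basis"
    then obtain j where "b = axis j 1" by (auto simp: Basis_vec_def)
    then show "(\<lambda>x. F x \<bullet> b) differentiable (at x)"
      using smooth_onD(1)[OF F[of j], of x] by (simp add: inner_axis)
  qed
  then show D: "(F has_derivative (\<lambda>v. jacobian F (at x) *v v)) (at x)"
    by (simp add: jacobian_works)
  have "((\<lambda>x. F x $ k) has_derivative (\<lambda>v. (jacobian F (at x) *v v) $ k)) (at x)"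
    by (rule bounded_linear.has_derivative[OF bounded_linear_vec_nth D])
  from pd_eq[OF this, of i] show "jacobian F (at x) $ k $ i = pd i (\<lambda>x. F x $ k) x"
    by (simp add: matrix_vector_mult_basis column_def)
qed

lemma pd_compose:
  assumes F: "(F has_derivative (\<lambda>v. J *v v)) (at x)" and f: "f differentiable (at (F x))"
  shows "((\<lambda>x. f (F x)) has_derivative (\<lambda>v. (J *v v) $ 1 * pd 1 f (F x) + (J *v v) $ 2 * pd 2 f (F x))) (at x)"
    and "pd i (\<lambda>x. f (F x)) x = J $ 1 $ i * pd 1 f (F x) + J $ 2 $ i * pd 2 f (F x)"
proof -
  show D: "((\<lambda>x. f (F x)) has_derivative (\<lambda>v. (J *v v) $ 1 * pd 1 f (F x) + (J *v v) $ 2 * pd 2 f (F x))) (at x)"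
    by (rule has_derivative_compose[OF F has_derivative_pd[OF f]])
  show "pd i (\<lambda>x. f (F x)) x = J $ 1 $ i * pd 1 f (F x) + J $ 2 $ i * pd 2 f (F x)"
    by (simp add: pd_eq[OF D] matrix_vector_mult_basis column_def)
qed

lemma torus_diffeo_smooth:
  assumes "torus_diffeo F"
  shows "\<And>i. smooth_on UNIV (\<lambda>x. F x $ i)" "\<And>i. smooth_on UNIV (\<lambda>x. inv F x $ i)"
  using assms by (simp_all add: torus_diffeo_def)

lemma torus_diffeo_continuous:
  assumes "torus_diffeo F"
  shows "continuous_on S F" "continuous_on S (inv F)"
  using has_derivative_continuous[OF smooth_map_derivative(1)[OF torus_diffeo_smooth(1)[OF assms]]]
    has_derivative_continuous[OF smooth_map_derivative(1)[OF torus_diffeo_smooth(2)[OF assms]]]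
  by (auto intro!: continuous_at_imp_continuous_on)

lemma torus_diffeo_jacobian_continuous:
  assumes "torus_diffeo F"
  shows "continuous_on S (\<lambda>x. jacobian F (at x) $ k $ i)"
  unfolding smooth_map_derivative(2)[OF torus_diffeo_smooth(1)[OF assms]]
  by (rule continuous_on_differentiable, rule smooth_onD(2)[OF torus_diffeo_smooth(1)[OF assms]]) simp

lemma nn_integral_diffeo_le:
  fixes \<phi> :: "real^2 \<Rightarrow> real"
  assumes F: "torus_diffeo F" and \<phi>: "continuous_on UNIV \<phi>" "torus_periodic \<phi>" "\<And>x. 0 \<le> \<phi> x"
  shows "(\<integral>\<^sup>+x. ennreal (det (jacobian F (at x)) * \<phi> (F x)) * indicator unit_cell x \<partial>lborel)
    \<le> (\<integral>\<^sup>+x. ennreal (\<phi> x) * indicator unit_cell x \<partial>lborel)"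
proof -
  let ?J = "\<lambda>x. jacobian F (at x)"
  have bij: "bij F" and detpos: "det (?J x) > 0" for x
    using F by (auto simp: torus_diffeo_def)
  have invF: "inv F (F x) = x" "F (inv F y) = y" for x y
    using bij by (auto simp: bij_def surj_f_inv_f)
  have DF: "(F has_derivative (\<lambda>v. ?J x *v v)) (at x)" for x
    by (rule smooth_map_derivative(1)[OF torus_diffeo_smooth(1)[OF F]])
  have DI: "(inv F has_derivative (\<lambda>v. jacobian (inv F) (at x) *v v)) (at x)" for x
    by (rule smooth_map_derivative(1)[OF torus_diffeo_smooth(2)[OF F]])
  let ?h = "\<lambda>x. det (?J x) * \<phi> (F x)"
  have "continuous_on (cbox 0 1) ?h"
    unfolding det_2
    by (intro continuous_intros torus_diffeo_jacobian_continuous[OF F]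
        continuous_on_compose2[OF \<phi>(1) torus_diffeo_continuous(1)[OF F]]) auto
  then have "?h absolutely_integrable_on cbox 0 1"
    by (rule absolutely_integrable_continuous)
  then have "?h absolutely_integrable_on unit_cell"
    by (rule set_integrable_subset) (auto simp: unit_cell_def mem_box_cart less_imp_le
        unit_cell_measurable[unfolded unit_cell_def])
  then have "?h integrable_on unit_cell"
    by (rule set_lebesgue_integral_eq_integral(1))
  then obtain b where b: "(?h has_integral b) unit_cell" by blast
  have "((\<lambda>x. \<bar>det (matrix (\<lambda>v. ?J x *v v))\<bar> * \<phi> (F x)) has_integral b) unit_cell
      \<longleftrightarrow> (\<phi> has_integral b) (F ` unit_cell)"
  proof (rule cov_invertible_nonneg_eq)
    show "(F has_derivative (\<lambda>v. ?J x *v v)) (at x within unit_cell)" for x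
      by (rule has_derivative_at_withinI[OF DF])
    show "(inv F has_derivative (\<lambda>v. jacobian (inv F) (at y) *v v)) (at y within F ` unit_cell)" for y
      by (rule has_derivative_at_withinI[OF DI])
    fix y
    have "((\<lambda>x. inv F (F x)) has_derivative (\<lambda>v. jacobian (inv F) (at (F (inv F y))) *v (?J (inv F y) *v v)))
        (at (inv F y))"
      by (rule has_derivative_compose[OF DF DI])
    then have "((\<lambda>x. x) has_derivative (\<lambda>v. jacobian (inv F) (at y) *v (?J (inv F y) *v v))) (at (inv F y))"
      by (simp only: invF)
    from has_derivative_unique[OF this has_derivative_ident]
    show "(\<lambda>v. jacobian (inv F) (at y) *v v) \<circ> (\<lambda>v. ?J (inv F y) *v v) = id"
      by (simp add: fun_eq_iff)
  qed (auto simp: invF \<phi>(3))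
  then have b': "(\<phi> has_integral b) (F ` unit_cell)"
    using b detpos by (simp add: less_imp_le)
  have "(\<integral>\<^sup>+x. ennreal (?h x) * indicator unit_cell x \<partial>lborel) = ennreal b"
    using detpos \<phi>(3) by (intro nn_integral_has_integral_lebesgue' b) (simp add: less_imp_le)
  also have "\<dots> = (\<integral>\<^sup>+x. ennreal (\<phi> x) * indicator (F ` unit_cell) x \<partial>lborel)"
    by (intro nn_integral_has_integral_lebesgue'[symmetric] b' \<phi>(3))
  also have "\<dots> \<le> (\<integral>\<^sup>+x. ennreal (\<phi> x) * indicator unit_cell x \<partial>lborel)"
  proof (rule nn_integral_periodic_le)
    have [measurable]: "\<phi> \<in> borel_measurable borel"
      by (rule borel_measurable_continuous_onI[OF \<phi>(1)])
    show "(\<lambda>x. ennreal (\<phi> x)) \<in> borel_measurable borel" by measurable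
    have inv_meas: "inv F \<in> borel_measurable borel"
      by (rule borel_measurable_continuous_onI[OF torus_diffeo_continuous(2)[OF F]])
    have "F ` unit_cell = inv F -` unit_cell \<inter> space borel"
      using invF by (auto simp: image_iff) metis
    also have "\<dots> \<in> sets borel"
      by (rule measurable_sets[OF inv_meas unit_cell_measurable])
    finally show "F ` unit_cell \<in> sets borel" .
    show "torus_periodic (\<lambda>x. ennreal (\<phi> x))"
      using \<phi>(2) by (simp add: torus_periodic_def)
    fix x y assume "x \<in> F ` unit_cell" "y \<in> F ` unit_cell" and xy: "x - y \<in> int_lattice"
    then obtain x' y' where x': "x = F x'" "x' \<in> unit_cell" and y': "y = F y'" "y' \<in> unit_cell"
      by blast
    have "inv F (y + (x - y)) - inv F y \<in> int_lattice"
      using F xy unfolding torus_diffeo_def by blast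
    then have "x' - y' \<in> int_lattice" by (simp add: x' y' invF)
    then show "x = y" using unit_cell_inj_mod_lattice x' y' by blast
  qed
  finally show ?thesis .
qed

text \<open>In dimension two the conformal factor multiplies the numerator and
  \<open>sqrt (det (g' x))\<close> alike and cancels. The pullback contributes the squared Jacobian
  determinant to the numerator and its first power to the root, since orientation is
  preserved.\<close>

lemma energy_density_conformal_pullback:
  assumes g: "torus_metric g" and F: "torus_diffeo F"
    and g': "g' x = exp (2 * u) *\<^sub>R pullback_metric F g x"
    and f: "f differentiable (at (F x))"
  shows "energy_density g' (\<lambda>x. f (F x)) x = det (jacobian F (at x)) * energy_density g f (F x)"
proof -
  define J where "J = jacobian F (at x)"
  define p q r s where "p = J $ 1 $ 1" "q = J $ 1 $ 2" "r = J $ 2 $ 1" "s = J $ 2 $ 2"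
  note J = this
  define a b c where "a = g (F x) $ 1 $ 1" "b = g (F x) $ 1 $ 2" "c = g (F x) $ 2 $ 2"
  note G = this
  have b': "g (F x) $ 2 $ 1 = b" by (simp add: G torus_metric_sym[OF g])
  define E where "E = exp (2 * u)"
  define X Y where "X = pd 1 f (F x)" "Y = pd 2 f (F x)"
  note XY = this
  have E: "E > 0" by (simp add: E_def)
  have detJ: "p * s - q * r > 0"
    using F by (simp add: torus_diffeo_def det_2 J J_def)
  have detg: "a * c - b * b > 0"
    using torus_metric_det_pos[OF g, of "F x"] by (simp add: det_2 b' G)
  have g'_E: "g' x = E *\<^sub>R pullback_metric F g x"
    by (simp only: g' E_def)
  have g'_eq: "g' x $ 1 $ 1 = E * (a * p * p + 2 * b * p * r + c * r * r)"
    "g' x $ 1 $ 2 = E * (a * p * q + b * (p * s + q * r) + c * r * s)"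
    "g' x $ 2 $ 1 = E * (a * p * q + b * (p * s + q * r) + c * r * s)"
    "g' x $ 2 $ 2 = E * (a * q * q + 2 * b * q * s + c * s * s)"
    unfolding g'_E
    by (simp_all add: pullback_metric_def matrix_matrix_mult_def transpose_def sum_2 b'
        J_def[symmetric] J[symmetric] G[symmetric] algebra_simps)
  have pd: "pd 1 (\<lambda>x. f (F x)) x = p * X + r * Y" "pd 2 (\<lambda>x. f (F x)) x = q * X + s * Y"
    using pd_compose(2)[OF smooth_map_derivative(1)[OF torus_diffeo_smooth(1)[OF F]] f]
    by (simp_all add: J J_def XY)
  have det': "det (g' x) = (E * (p * s - q * r))\<^sup>2 * (a * c - b * b)"
    by (simp add: det_2 g'_eq power2_eq_square algebra_simps)
  have sq: "sqrt (det (g' x)) = E * (p * s - q * r) * sqrt (a * c - b * b)"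
    using E detJ by (simp add: det' real_sqrt_mult)
  \<comment> \<open>The adjugate of \<open>J\<^sup>T g J\<close>, evaluated at
    \<open>J\<^sup>T\<close> applied to a covector, is \<open>(det J)\<^sup>2\<close> times the
    adjugate of \<open>g\<close> at that covector.\<close>
  have num: "g' x $ 2 $ 2 * (p * X + r * Y)\<^sup>2 - 2 * g' x $ 1 $ 2 * (p * X + r * Y) * (q * X + s * Y)
      + g' x $ 1 $ 1 * (q * X + s * Y)\<^sup>2
    = (E * (p * s - q * r)) * (p * s - q * r) * (c * X\<^sup>2 - 2 * b * X * Y + a * Y\<^sup>2)"
    by (simp add: g'_eq power2_eq_square algebra_simps)
  have "energy_density g' (\<lambda>x. f (F x)) x
    = (E * (p * s - q * r)) * (p * s - q * r) * (c * X\<^sup>2 - 2 * b * X * Y + a * Y\<^sup>2)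
      / (E * (p * s - q * r) * sqrt (a * c - b * b))"
    unfolding energy_density_def pd num sq ..
  also have "\<dots> = (p * s - q * r) * ((c * X\<^sup>2 - 2 * b * X * Y + a * Y\<^sup>2) / sqrt (a * c - b * b))"
    using E detJ by simp
  finally show ?thesis
    by (simp add: energy_density_def det_2 b' J J_def G XY)
qed

text \<open>\<open>F\<close> carries lattice translates to lattice translates, so integrality of the
  differences persists. Periodicity of the composite would be transported back to \<open>f\<close>
  by \<open>inv F\<close>.\<close>

lemma essential_circle_map_compose:
  assumes f: "essential_circle_map f" and F: "torus_diffeo F"
  shows "essential_circle_map (\<lambda>x. f (F x))"
  unfolding essential_circle_map_def
proof (intro conjI allI ballI)
  have fd: "f differentiable (at x)" and fc: "continuous_on UNIV (pd i f)" for x i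
    using f by (auto simp: essential_circle_map_def)
  note c = pd_compose[OF smooth_map_derivative(1)[OF torus_diffeo_smooth(1)[OF F]] fd]
  show "(\<lambda>x. f (F x)) differentiable (at x)" for x
    using c(1) by (rule differentiableI)
  show "continuous_on UNIV (pd i (\<lambda>x. f (F x)))" for i
    unfolding c(2)[abs_def]
    by (intro continuous_intros torus_diffeo_jacobian_continuous[OF F]
        continuous_on_compose2[OF fc torus_diffeo_continuous(1)[OF F]]) auto
  have shift: "F (x + n) - F x \<in> int_lattice" "inv F (x + n) - inv F x \<in> int_lattice"
    if "n \<in> int_lattice" for x n
    using F that by (auto simp: torus_diffeo_def)
  fix x n assume n: "n \<in> int_lattice"
  have "f (F x + (F (x + n) - F x)) - f (F x) \<in> \<int>"
    using f shift(1)[OF n] unfolding essential_circle_map_def by blast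
  then show "f (F (x + n)) - f (F x) \<in> \<int>" by simp
next
  have invF: "F (inv F y) = y" for y
    using F by (auto simp: torus_diffeo_def bij_def surj_f_inv_f)
  show "\<not> torus_periodic (\<lambda>x. f (F x))"
  proof
    assume per: "torus_periodic (\<lambda>x. f (F x))"
    have "torus_periodic f"
      unfolding torus_periodic_def
    proof (intro allI ballI)
      fix y n assume "n \<in> int_lattice"
      then have "inv F (y + n) - inv F y \<in> int_lattice"
        using F by (auto simp: torus_diffeo_def)
      then have "f (F (inv F y + (inv F (y + n) - inv F y))) = f (F (inv F y))"
        using per unfolding torus_periodic_def by blast
      then show "f (y + n) = f y" by (simp add: invF)
    qed
    then show False using f by (simp add: essential_circle_map_def)
  qed
qed

lemma torus_periodic_pd:
  assumes diff: "\<And>x. f differentiable (at x)"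
    and n: "\<And>x. f (x + n) = f x + k"
  shows "pd i f (x + n) = pd i f x"
proof -
  have "((\<lambda>x. x + n) has_derivative (\<lambda>v. v)) (at x)"
    by (auto intro!: derivative_eq_intros)
  from has_derivative_compose[OF this has_derivative_pd[OF diff]]
  have "((\<lambda>x. f x + k) has_derivative (\<lambda>v. v $ 1 * pd 1 f (x + n) + v $ 2 * pd 2 f (x + n))) (at x)"
    by (simp add: n)
  moreover have "((\<lambda>x. f x + k) has_derivative (\<lambda>v. v $ 1 * pd 1 f x + v $ 2 * pd 2 f x)) (at x)"
    using has_derivative_add_const[OF has_derivative_pd[OF diff]] .
  ultimately have "(\<lambda>v::real^2. v $ 1 * pd 1 f (x + n) + v $ 2 * pd 2 f (x + n)) = (\<lambda>v. v $ 1 * pd 1 f x + v $ 2 * pd 2 f x)"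
    by (rule has_derivative_unique)
  from fun_cong[OF this, of "axis i 1"] show ?thesis
    using exhaust_2[of i] by (auto simp: axis_def)
qed

text \<open>\<open>f\<close> is periodic only up to additive integers, but these disappear on
  differentiation.\<close>

lemma energy_density_periodic:
  assumes g: "torus_metric g" and f: "essential_circle_map f"
  shows "torus_periodic (energy_density g f)"
  unfolding torus_periodic_def
proof (intro allI ballI)
  fix x n assume n: "n \<in> int_lattice"
  obtain k where k: "f (x + n) = f x + k" for x
    using essential_circle_map_lattice_shift[OF f n] by blast
  have "f differentiable (at x)" for x
    using f by (simp add: essential_circle_map_def)
  from torus_periodic_pd[OF this k] have "pd i f (x + n) = pd i f x" for i .
  then show "energy_density g f (x + n) = energy_density g f x"
    using torus_metric_periodic[OF g n] by (simp add: energy_density_def)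
qed

lemma energy_density_continuous:
  assumes g: "torus_metric g" and f: "essential_circle_map f"
  shows "continuous_on UNIV (energy_density g f)"
proof -
  have fc: "continuous_on UNIV (\<lambda>x. pd i f x)" for i
    using f by (simp add: essential_circle_map_def)
  have gc: "continuous_on UNIV (\<lambda>x. g x $ i $ j)" for i j
    by (rule torus_metric_continuous[OF g])
  have "continuous_on UNIV (\<lambda>x. det (g x))"
    unfolding det_2 by (intro continuous_on_diff continuous_on_mult gc)
  then show ?thesis
    unfolding energy_density_def[abs_def]
    by (intro continuous_on_divide continuous_on_add continuous_on_diff continuous_on_mult
        continuous_on_power continuous_on_const continuous_on_real_sqrt gc
        fc) (use torus_metric_det_pos[OF g] in \<open>auto simp: less_le\<close>)
qed

text \<open>Together with \<open>essential_circle_map_compose\<close>, this transfers a lower bound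
  for all essential maps from \<open>g'\<close> to \<open>g\<close>.\<close>

lemma energy_pullback_le:
  assumes g: "torus_metric g" and F: "torus_diffeo F"
    and g': "\<And>x. g' x = exp (2 * u x) *\<^sub>R pullback_metric F g x"
    and f: "essential_circle_map f"
  shows "energy g' (\<lambda>x. f (F x)) \<le> energy g f"
proof -
  have "f differentiable (at x)" for x
    using f by (simp add: essential_circle_map_def)
  then have "energy_density g' (\<lambda>x. f (F x)) x = det (jacobian F (at x)) * energy_density g f (F x)" for x
    by (rule energy_density_conformal_pullback[OF g F g'])
  then show ?thesis
    unfolding energy_def
    using nn_integral_diffeo_le[OF F energy_density_continuous[OF g f] energy_density_periodic[OF g f]
        energy_density_nonneg[OF g]] by simp
qed

subsection \<open>Unboundedness in the moduli space\<close>

text \<open>Identity map and zero conformal exponent. Reflexivity turns equality of two classes into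
  an actual conformal diffeomorphism between the metrics.\<close>

lemma moduli_class_self:
  assumes "torus_metric g"
  shows "g \<in> moduli_class g"
proof -
  \<comment> \<open>The list of derivatives of the identity: \<open>t\<close>, \<open>1\<close>, and
    then \<open>0\<close> throughout.\<close>
  have D: "((\<lambda>n t. if n = 0 then t else if n = 1 then 1 else 0) n has_real_derivative
      (\<lambda>n t. if n = 0 then t else if n = 1 then 1 else 0) (Suc n) t) (at t)" for n :: nat and t :: real
    by auto
  have sm: "smooth_on UNIV (\<lambda>x. x $ i)" for i
    using smooth_on_component[where D = "\<lambda>n t. if n = 0 then t else if n = 1 then 1 else 0", OF D, of UNIV i]
    by simp
  have "((\<lambda>x::real^2. x) has_derivative (\<lambda>v. mat 1 *v v)) (at x)" for x
    by simp
  then have "jacobian (\<lambda>x::real^2. x) (at x) = mat 1" for x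
    unfolding jacobian_def
    by (simp add: frechet_derivative_at[symmetric] matrix_def mat_def axis_def vec_eq_iff)
  then have jac: "jacobian id (at x :: (real^2) filter) = mat 1" for x
    by (simp add: id_def)
  have "torus_diffeo id"
    using sm by (simp add: torus_diffeo_def jac)
  moreover have "g x = exp (2 * 0) *\<^sub>R pullback_metric id g x" for x
    by (simp add: pullback_metric_def jac transpose_mat)
  moreover have "torus_periodic (\<lambda>x. 0 :: real)"
    by (simp add: torus_periodic_def)
  ultimately show ?thesis
    unfolding moduli_class_def using assms smooth_on_const[of UNIV 0] by blast
qed

section \<open>Stability of the energy under small changes of the metric\<close>

lemma torus_metric_bounds:
  assumes g: "torus_metric g"
  obtains M d where "M \<ge> 1" "d > 0" "\<And>x i j. \<bar>g x $ i $ j\<bar> \<le> M" "\<And>x. d \<le> det (g x)"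
proof -
  have per: "torus_periodic (\<lambda>x. F (g x))" for F :: "real^2^2 \<Rightarrow> real"
    using torus_metric_periodic[OF g] by (simp add: torus_periodic_def)
  have gc: "continuous_on UNIV (\<lambda>x. g x $ i $ j)" for i j
    by (rule torus_metric_continuous[OF g])
  have "\<exists>B. \<forall>x. \<bar>g x $ i $ j\<bar> \<le> B" for i j
  proof -
    obtain z where "- \<bar>g z $ i $ j\<bar> \<le> - \<bar>g x $ i $ j\<bar>" for x
      using torus_periodic_attains_inf[OF per[of "\<lambda>A. - \<bar>A $ i $ j\<bar>"]
          continuous_on_minus[OF continuous_on_rabs[OF gc[of i j]]]] by blast
    then show ?thesis by (intro exI[of _ "\<bar>g z $ i $ j\<bar>"]) simp
  qed
  then obtain B where B: "\<bar>g x $ i $ j\<bar> \<le> B i j" for i j x by metis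
  have "continuous_on UNIV (\<lambda>x. det (g x))"
    unfolding det_2 by (intro continuous_on_diff continuous_on_mult gc)
  from torus_periodic_attains_inf[OF per this] obtain z where z: "det (g z) \<le> det (g x)" for x
    by blast
  define M where "M = 1 + (\<Sum>i\<in>UNIV. \<Sum>j\<in>UNIV. \<bar>B i j\<bar>)"
  have "\<bar>g x $ i $ j\<bar> \<le> M" for x i j
  proof -
    have "\<bar>g x $ i $ j\<bar> \<le> \<bar>B i j\<bar>" using B[of x i j] by linarith
    also have "\<dots> \<le> (\<Sum>j\<in>UNIV. \<bar>B i j\<bar>)"
      by (rule member_le_sum) auto
    also have "\<dots> \<le> (\<Sum>i\<in>UNIV. \<Sum>j\<in>UNIV. \<bar>B i j\<bar>)"
      by (rule member_le_sum[where f = "\<lambda>i. \<Sum>j\<in>UNIV. \<bar>B i j\<bar>"]) (auto intro: sum_nonneg)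
    finally show ?thesis by (simp add: M_def)
  qed
  moreover have "M \<ge> 1" by (simp add: M_def sum_nonneg)
  ultimately show ?thesis using that z torus_metric_det_pos[OF g] by blast
qed

lemma abs_mult_diff_le:
  fixes a b a' b' e M :: real
  assumes "\<bar>a' - a\<bar> \<le> e" "\<bar>b' - b\<bar> \<le> e" "\<bar>a\<bar> \<le> M" "\<bar>b\<bar> \<le> M" "e \<le> 1"
  shows "\<bar>a' * b' - a * b\<bar> \<le> e * (2 * M + 1)"
proof -
  have "e \<ge> 0" using assms(1) by linarith
  have "a' * b' - a * b = (a' - a) * (b' - b) + (a' - a) * b + a * (b' - b)"
    by (simp add: algebra_simps)
  also have "\<bar>\<dots>\<bar> \<le> \<bar>a' - a\<bar> * \<bar>b' - b\<bar> + \<bar>a' - a\<bar> * \<bar>b\<bar> + \<bar>a\<bar> * \<bar>b' - b\<bar>"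
    unfolding abs_mult[symmetric] by linarith
  also have "\<dots> \<le> e * 1 + e * M + M * e"
    using assms \<open>e \<ge> 0\<close> by (intro add_mono mult_mono) auto
  finally show ?thesis by (simp add: algebra_simps)
qed

text \<open>Uniform closeness of the coefficients alone controls the numerator and the determinant.
  The estimate is relative and uniform in \<open>f\<close>, because the numerator dominates a fixed
  multiple of \<open>p\<^sup>2 + q\<^sup>2\<close>.\<close>

lemma energy_density_nhd:
  assumes g: "torus_metric g" and \<theta>: "0 < \<theta>" "\<theta> < 1"
  obtains e where "e > 0"
    "\<And>g' f x. g' \<in> metric_nhd g 0 e \<Longrightarrow> \<theta> * energy_density g f x \<le> energy_density g' f x"
proof -
  obtain M d where M: "M \<ge> 1" "\<And>x i j. \<bar>g x $ i $ j\<bar> \<le> M" and d: "d > 0" "\<And>x. d \<le> det (g x)"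
    using torus_metric_bounds[OF g] by metis
  \<comment> \<open>Chosen so that \<open>(1 - \<delta>) / (1 + \<delta>) = \<theta>\<close>: the
    numerator keeps a fraction \<open>1 - \<delta>\<close>, and the root of the determinant grows by
    at most \<open>1 + \<delta>\<close>.\<close>
  define \<delta> where "\<delta> = (1 - \<theta>) / (1 + \<theta>)"
  have \<delta>: "0 < \<delta>" "\<theta> * (1 + \<delta>) = 1 - \<delta>"
    using \<theta> by (auto simp: \<delta>_def field_simps)
  \<comment> \<open>Each of the two products in the determinant changes by at most
    \<open>e * (2 * M + 1)\<close>, provided \<open>e \<le> 1\<close>. The same
    \<open>4 * M + 2\<close> also dominates the factor \<open>2 * (a + c)\<close> in the numerator
    estimate.\<close>
  define e where "e = min 1 (\<delta> * d / (4 * M + 2))"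
  have e: "0 < e" "e \<le> 1" "e * (4 * M + 2) \<le> \<delta> * d"
  proof -
    show "0 < e" "e \<le> 1" using \<delta> d M by (auto simp: e_def)
    have "e \<le> \<delta> * d / (4 * M + 2)" by (simp add: e_def)
    then show "e * (4 * M + 2) \<le> \<delta> * d" using M by (simp add: pos_le_divide_eq)
  qed
  have "\<theta> * energy_density g f x \<le> energy_density g' f x" if nhd: "g' \<in> metric_nhd g 0 e" for g' f x
  proof -
    have g': "torus_metric g'" using nhd by (simp add: metric_nhd_def)
    have near: "\<bar>g' x $ i $ j - g x $ i $ j\<bar> \<le> e" for i j
    proof -
      have "\<bar>pds [] (\<lambda>z. g' z $ i $ j) x - pds [] (\<lambda>z. g z $ i $ j) x\<bar> < e"
        using nhd unfolding metric_nhd_def by (metis (mono_tags, lifting) le0 list.size(3) mem_Collect_eq)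
      then show ?thesis by (simp add: pds_def)
    qed
    define p q where "p = pd 1 f x" and "q = pd 2 f x"
    define a b c where "a = g x $ 1 $ 1" and "b = g x $ 1 $ 2" and "c = g x $ 2 $ 2"
    define a' b' c' where "a' = g' x $ 1 $ 1" and "b' = g' x $ 1 $ 2" and "c' = g' x $ 2 $ 2"
    define Q where "Q = c * p\<^sup>2 - 2 * b * p * q + a * q\<^sup>2"
    define Q' where "Q' = c' * p\<^sup>2 - 2 * b' * p * q + a' * q\<^sup>2"
    define D where "D = det (g x)"
    define D' where "D' = det (g' x)"
    have D: "D = a * c - b * b" "D' = a' * c' - b' * b'"
      by (simp_all add: D_def D'_def det_2 a_def b_def c_def a'_def b'_def c'_def
          torus_metric_sym[OF g] torus_metric_sym[OF g'])
    have pos: "a > 0" "c > 0" "D \<ge> d" "D > 0" "D' > 0"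
      using torus_metric_diag_pos[OF g, of x] torus_metric_det_pos[OF g', of x] d(1) d(2)[of x]
      by (auto simp: a_def c_def D_def D'_def)
    have "\<bar>a' * c' - a * c\<bar> \<le> e * (2 * M + 1)" "\<bar>b' * b' - b * b\<bar> \<le> e * (2 * M + 1)"
      unfolding a_def b_def c_def a'_def b'_def c'_def
      by (intro abs_mult_diff_le near M e)+
    then have "D' \<le> D + e * (4 * M + 2)"
      unfolding D by (simp add: algebra_simps abs_le_iff)
    also have "\<dots> \<le> D + \<delta> * D"
      using e(3) mult_left_mono[OF pos(3), of \<delta>] \<delta>(1) by linarith
    also have "\<dots> \<le> (1 + \<delta>)\<^sup>2 * D"
      using pos \<delta> by (simp add: power2_eq_square algebra_simps)
    finally have "sqrt D' \<le> sqrt ((1 + \<delta>)\<^sup>2 * D)"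
      by simp
    then have sqrtD: "sqrt D' \<le> (1 + \<delta>) * sqrt D"
      using \<delta> by (simp add: real_sqrt_mult)
    \<comment> \<open>This lower bound converts the absolute error
      \<open>2 * e * (p\<^sup>2 + q\<^sup>2)\<close> into the relative error
      \<open>\<delta> * Q\<close>.\<close>
    have Q: "D / (a + c) * (p\<^sup>2 + q\<^sup>2) \<le> Q"
      using tr_form_ge_det[OF pos(1,2), of b p q] by (simp add: Q_def D power2_eq_square)
    have pq: "2 * \<bar>p * q\<bar> \<le> p\<^sup>2 + q\<^sup>2"
      using zero_le_power2[of "\<bar>p\<bar> - \<bar>q\<bar>"] by (simp add: power2_eq_square algebra_simps abs_mult)
    have "Q - Q' = (c - c') * p\<^sup>2 + (b' - b) * (2 * (p * q)) + (a - a') * q\<^sup>2"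
      by (simp add: Q_def Q'_def algebra_simps)
    also have "\<dots> \<le> e * p\<^sup>2 + e * (p\<^sup>2 + q\<^sup>2) + e * q\<^sup>2"
    proof (intro add_mono)
      show "(c - c') * p\<^sup>2 \<le> e * p\<^sup>2" "(a - a') * q\<^sup>2 \<le> e * q\<^sup>2"
        using near[of 1 1] near[of 2 2]
        by (auto intro!: mult_right_mono simp: a_def c_def a'_def c'_def)
      have "(b' - b) * (2 * (p * q)) \<le> \<bar>b' - b\<bar> * (2 * \<bar>p * q\<bar>)"
        using abs_ge_self[of "(b' - b) * (2 * (p * q))"] by (simp add: abs_mult)
      also have "\<dots> \<le> e * (p\<^sup>2 + q\<^sup>2)"
        using near[of 1 2] pq e by (intro mult_mono) (auto simp: b_def b'_def)
      finally show "(b' - b) * (2 * (p * q)) \<le> e * (p\<^sup>2 + q\<^sup>2)" .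
    qed
    also have "\<dots> = 2 * e * (p\<^sup>2 + q\<^sup>2)"
      by (simp add: algebra_simps)
    also have "\<dots> \<le> \<delta> * (D / (a + c)) * (p\<^sup>2 + q\<^sup>2)"
    proof (intro mult_right_mono)
      have "a + c \<le> 2 * M"
        using M(2)[of x 1 1] M(2)[of x 2 2] by (simp add: a_def c_def)
      then have "2 * e * (a + c) \<le> 2 * e * (2 * M)"
        using e by (intro mult_left_mono) auto
      also have "\<dots> \<le> e * (4 * M + 2)" using e by (simp add: algebra_simps)
      also have "\<dots> \<le> \<delta> * D" using e(3) mult_left_mono[OF pos(3), of \<delta>] \<delta>(1) by linarith
      finally show "2 * e \<le> \<delta> * (D / (a + c))"
        using pos by (simp add: pos_le_divide_eq)
    qed simp
    also have "\<dots> \<le> \<delta> * Q"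
      using mult_left_mono[OF Q, of \<delta>] \<delta> by (simp add: mult.assoc)
    finally have QQ: "(1 - \<delta>) * Q \<le> Q'" by (simp add: algebra_simps)
    have "0 \<le> D / (a + c) * (p\<^sup>2 + q\<^sup>2)" using pos by simp
    then have Q0: "Q \<ge> 0" using Q by linarith
    have "\<theta> * (Q / sqrt D) = (\<theta> * (1 + \<delta>) * Q) / ((1 + \<delta>) * sqrt D)"
      using \<delta>(1) by simp
    also have "\<dots> = (1 - \<delta>) * Q / ((1 + \<delta>) * sqrt D)" by (simp only: \<delta>(2))
    also have "\<dots> \<le> (1 - \<delta>) * Q / sqrt D'"
    proof (rule divide_left_mono[OF sqrtD])
      have "0 \<le> \<theta> * (1 + \<delta>)" using \<theta> \<delta>(1) by simp
      then show "0 \<le> (1 - \<delta>) * Q" using Q0 by (simp add: \<delta>(2))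
      show "0 < (1 + \<delta>) * sqrt D * sqrt D'" using pos \<delta>(1) by simp
    qed
    also have "\<dots> \<le> Q' / sqrt D'"
      using QQ pos by (intro divide_right_mono) auto
    finally show ?thesis
      by (simp add: energy_density_def Q_def Q'_def D_def D'_def p_def q_def
          a_def b_def c_def a'_def b'_def c'_def)
  qed
  then show ?thesis using that e(1) by blast
qed

section \<open>Energy and compactness in the moduli space\<close>

text \<open>These sets are open and unions of moduli classes, and they exhaust the space of metrics as
  \<open>c\<close> tends to \<open>0\<close>; a compact subset of the moduli space lies in one of them.\<close>

definition energy_above :: "real \<Rightarrow> (real^2 \<Rightarrow> real^2^2) set" where
  "energy_above c = {g. torus_metric g \<and>
     (\<exists>c'>c. \<forall>f. essential_circle_map f \<longrightarrow> ennreal c' \<le> energy g f)}"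

text \<open>The strict inequality \<open>c < c'\<close> in \<open>energy_above\<close> leaves room
  to lose a factor \<open>\<theta> < 1\<close>.\<close>

lemma metric_open_energy_above:
  assumes c: "c > 0"
  shows "metric_open (energy_above c)"
  unfolding metric_open_def
proof (intro conjI ballI)
  fix g assume "g \<in> energy_above c"
  then obtain c' where g: "torus_metric g" and c': "c' > c"
    "\<And>f. essential_circle_map f \<Longrightarrow> ennreal c' \<le> energy g f"
    by (auto simp: energy_above_def)
  show "torus_metric g" by (rule g)
  \<comment> \<open>With this choice \<open>\<theta> * c'\<close> is the midpoint of
    \<open>c\<close> and \<open>c'\<close>.\<close>
  define \<theta> where "\<theta> = (c + c') / (2 * c')"
  have \<theta>: "0 < \<theta>" "\<theta> < 1" "c < \<theta> * c'" using c c'(1) by (auto simp: \<theta>_def field_simps)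
  obtain e where e: "e > 0"
    "\<And>g' f x. g' \<in> metric_nhd g 0 e \<Longrightarrow> \<theta> * energy_density g f x \<le> energy_density g' f x"
    using energy_density_nhd[OF g \<theta>(1,2)] by blast
  have "g' \<in> energy_above c" if g': "g' \<in> metric_nhd g 0 e" for g'
  proof -
    have "ennreal (\<theta> * c') \<le> energy g' f" if f: "essential_circle_map f" for f
    proof -
      have [measurable]: "energy_density g f \<in> borel_measurable borel"
        by (rule borel_measurable_continuous_onI[OF energy_density_continuous[OF g f]])
      have "ennreal (\<theta> * c') = ennreal \<theta> * ennreal c'"
        using \<theta>(1) by (simp add: ennreal_mult')
      also have "\<dots> \<le> ennreal \<theta> * energy g f"
        by (intro mult_left_mono c'(2) f) simp
      also have "\<dots> = (\<integral>\<^sup>+x. ennreal \<theta> * (ennreal (energy_density g f x) * indicator unit_cell x) \<partial>lborel)"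
        unfolding energy_def by (rule nn_integral_cmult[symmetric]) measurable
      also have "\<dots> \<le> energy g' f"
      proof -
        have "ennreal \<theta> * ennreal (energy_density g f x) \<le> ennreal (energy_density g' f x)" for x
          using \<theta>(1) e(2)[OF g', of f x] by (simp add: ennreal_mult'[symmetric] ennreal_leI)
        then show ?thesis
          unfolding energy_def mult.assoc[symmetric] by (intro nn_integral_mono mult_right_mono) auto
      qed
      finally show ?thesis .
    qed
    moreover have "torus_metric g'" using g' by (simp add: metric_nhd_def)
    ultimately show ?thesis
      unfolding energy_above_def using \<theta>(3) by blast
  qed
  then show "\<exists>N e. e > 0 \<and> metric_nhd g N e \<subseteq> energy_above c"
    using e(1) by blast
qed

text \<open>\<open>g\<close> is a conformal pullback of \<open>g'\<close>, so an essential map for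
  \<open>g'\<close> composes to one for \<open>g\<close> of no greater energy.\<close>

lemma energy_above_moduli_class:
  assumes g: "g \<in> energy_above c" and g': "torus_metric g'" and eq: "moduli_class g' = moduli_class g"
  shows "g' \<in> energy_above c"
proof -
  obtain c' where gm: "torus_metric g" and c': "c' > c"
    "\<And>f. essential_circle_map f \<Longrightarrow> ennreal c' \<le> energy g f"
    using g by (auto simp: energy_above_def)
  have "g \<in> moduli_class g'"
    unfolding eq by (rule moduli_class_self[OF gm])
  then obtain F u where F: "torus_diffeo F" "\<And>x. g x = exp (2 * u x) *\<^sub>R pullback_metric F g' x"
    by (auto simp: moduli_class_def)
  have "ennreal c' \<le> energy g' f" if f: "essential_circle_map f" for f
    using c'(2)[OF essential_circle_map_compose[OF f F(1)]] energy_pullback_le[OF g' F f]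
    by (rule order_trans)
  then show ?thesis using g' c'(1) by (auto simp: energy_above_def)
qed

text \<open>By the preceding lemma the set is saturated for the quotient map, so the preimage of its
  image is the set itself, which is open.\<close>

lemma openin_moduli_energy_above:
  assumes "c > 0"
  shows "openin moduli_topology (moduli_class ` energy_above c)"
proof -
  have "{g \<in> topspace metric_topology. moduli_class g \<in> moduli_class ` energy_above c} = energy_above c"
  proof -
    have "energy_above c \<subseteq> Collect torus_metric" by (auto simp: energy_above_def)
    then show ?thesis
      unfolding topspace_metric_topology using energy_above_moduli_class by blast
  qed
  moreover have "moduli_class ` energy_above c \<subseteq> moduli_space"
    by (auto simp: moduli_space_def energy_above_def)
  ultimately show ?thesis
    by (simp add: openin_moduli_topology moduli_open_def openin_metric_topology metric_open_energy_above[OF assms])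
qed

lemma energy_above_antimono:
  assumes "c \<le> c'"
  shows "energy_above c' \<subseteq> energy_above c"
proof -
  have "c' < d \<Longrightarrow> c < d" for d using assms by simp
  then show ?thesis unfolding energy_above_def by blast
qed

text \<open>The images of the sets \<open>energy_above c\<close> are nested and cover the moduli
  space. A compact set therefore lies in a single one, where no metric has an essential map of
  energy at most \<open>c\<close>.\<close>

lemma unbounded_in_moduliI:
  assumes h: "\<And>k. torus_metric (h k)"
    and small: "\<And>c. c > 0 \<Longrightarrow> \<exists>k f. essential_circle_map f \<and> energy (h k) f \<le> ennreal c"
  shows "unbounded_in_moduli h"
  unfolding unbounded_in_moduli_def
proof
  assume "\<exists>K. compactin moduli_topology K \<and> (\<forall>k. moduli_class (h k) \<in> K)"
  then obtain K where K: "compactin moduli_topology K" "\<And>k. moduli_class (h k) \<in> K" by blast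
  define U where "U c = moduli_class ` energy_above c" for c
  have "K \<subseteq> \<Union> (U ` {0<..})"
  proof
    fix C assume "C \<in> K"
    then have "C \<in> moduli_space"
      using compactin_subset_topspace[OF K(1)] by (auto simp: topspace_moduli_topology)
    then obtain g where g: "torus_metric g" "C = moduli_class g" by (auto simp: moduli_space_def)
    obtain c where c: "c > 0" "\<And>f. essential_circle_map f \<Longrightarrow> ennreal c \<le> energy g f"
      using energy_lower_bound[OF g(1)] by blast
    \<comment> \<open>Halving the constant supplies the strict inequality in
      \<open>energy_above\<close>.\<close>
    have "g \<in> energy_above (c / 2)"
      unfolding energy_above_def using g(1) c by (auto intro!: exI[of _ c])
    then show "C \<in> \<Union> (U ` {0<..})" using g(2) c(1) by (auto simp: U_def intro!: bexI[of _ "c / 2"])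
  qed
  moreover have "openin moduli_topology V" if "V \<in> U ` {0<..}" for V
    using that openin_moduli_energy_above by (auto simp: U_def)
  ultimately obtain \<F> where \<F>: "finite \<F>" "\<F> \<subseteq> U ` {0<..}" "K \<subseteq> \<Union>\<F>"
    using K(1) unfolding compactin_def by metis
  from finite_subset_image[OF \<F>(1,2)] obtain A where A: "A \<subseteq> {0<..}" "finite A" "\<F> = U ` A"
    by blast
  have "A \<noteq> {}" using \<F>(3) K(2) A(3) by blast
  define c where "c = Min A"
  have c: "c > 0" "\<And>a. a \<in> A \<Longrightarrow> c \<le> a"
    using A(1,2) \<open>A \<noteq> {}\<close> Min_in[of A] by (auto simp: c_def)
  obtain k f where f: "essential_circle_map f" "energy (h k) f \<le> ennreal c"
    using small[OF c(1)] by blast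
  obtain a where "a \<in> A" "moduli_class (h k) \<in> U a"
    using \<F>(3) K(2)[of k] A(3) by blast
  then have "moduli_class (h k) \<in> U c"
    using energy_above_antimono[OF c(2)] by (auto simp: U_def)
  then obtain g where "g \<in> energy_above c" "moduli_class (h k) = moduli_class g"
    by (auto simp: U_def)
  then have "h k \<in> energy_above c"
    using energy_above_moduli_class h by blast
  then obtain c' where "c' > c" "ennreal c' \<le> energy (h k) f"
    using f(1) by (auto simp: energy_above_def)
  then have "ennreal c' \<le> ennreal c" using f(2) by (meson order_trans)
  then show False using c(1) \<open>c' > c\<close> by simp
qed

section \<open>The first coordinate on the long tori, and the conclusion\<close>

lemma coordinate_circle_map:
  "essential_circle_map (\<lambda>x. x $ 1)" "pd i (\<lambda>x. x $ 1) x = axis i 1 $ 1"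
proof -
  have D: "((\<lambda>x::real^2. x $ 1) has_derivative (\<lambda>v. v $ 1)) (at x)" for x
    by (rule bounded_linear_imp_has_derivative[OF bounded_linear_vec_nth])
  show pd: "pd i (\<lambda>x. x $ 1) x = axis i 1 $ 1" for i x
    by (rule pd_eq[OF D])
  have "\<not> torus_periodic (\<lambda>x::real^2. x $ 1)"
  proof
    assume "torus_periodic (\<lambda>x::real^2. x $ 1)"
    then have "(0 + axis 1 1 :: real^2) $ 1 = (0 :: real^2) $ 1"
      using axis_in_int_lattice unfolding torus_periodic_def by blast
    then show False by (simp add: axis_def)
  qed
  then show "essential_circle_map (\<lambda>x. x $ 1)"
    unfolding essential_circle_map_def pd[abs_def]
    using D by (auto simp: int_lattice_def differentiable_def)
qed

lemma energy_coordinate_long_torus: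
  assumes "a > 0"
  shows "energy (long_torus a) (\<lambda>x. x $ 1) = ennreal (1 / a\<^sup>2)"
proof -
  have "energy_density (long_torus a) (\<lambda>x. x $ 1) x = 1 / a\<^sup>2" for x
    using assms by (simp add: energy_density_def coordinate_circle_map(2) axis_def)
  then show ?thesis
    by (simp add: energy_def nn_integral_cmult)
qed

lemma unbounded_in_moduli_long_torus: "unbounded_in_moduli (\<lambda>k. long_torus (real (Suc k)))"
proof (rule unbounded_in_moduliI)
  fix c :: real assume "c > 0"
  then obtain k where k: "inverse (real (Suc k)) < c"
    using reals_Archimedean by blast
  have "1 / (real (Suc k))\<^sup>2 \<le> inverse (real (Suc k))"
    using mult_left_mono[of "inverse (real (Suc k))" 1 "inverse (real (Suc k))"]
    by (simp add: power2_eq_square inverse_eq_divide del: of_nat_Suc)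
  then have "energy (long_torus (real (Suc k))) (\<lambda>x. x $ 1) \<le> ennreal c"
    using k by (subst energy_coordinate_long_torus) (auto intro!: ennreal_leI)
  then show "\<exists>k f. essential_circle_map f \<and> energy (long_torus (real (Suc k))) f \<le> ennreal c"
    using coordinate_circle_map(1) by blast
qed (simp add: torus_metric_long_torus)

theorem proposition2p1:
  shows "\<exists>h :: nat \<Rightarrow> real^2 \<Rightarrow> real^2^2.
    (\<forall>k. torus_metric (h k) \<and> constant_curvature (h k) \<and> emeasure (torus_vol (h k)) UNIV = 1) \<and>
    unbounded_in_moduli h \<and>
    (\<forall>G :: nat \<Rightarrow> real^2 \<Rightarrow> real^2 \<Rightarrow> real.
       (\<forall>k. green_function (h k) (G k)) \<longrightarrow>
       (\<forall>y. (\<lambda>k. SUP t\<in>{0<..}. ennreal (t^2) *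
                emeasure (torus_vol (h k))
                  {x. x - y \<notin> int_lattice \<and> norm_differential (h k) (\<lambda>z. G k z y) x \<ge> t})
            \<longlonglongrightarrow> \<infinity>))"
proof (intro exI conjI allI impI)
  let ?h = "\<lambda>k. long_torus (real (Suc k))"
  show "torus_metric (?h k)" "constant_curvature (?h k)" "emeasure (torus_vol (?h k)) UNIV = 1" for k
    by (simp_all only: torus_metric_long_torus constant_curvature_long_torus
        emeasure_torus_vol_long_torus of_nat_0_less_iff zero_less_Suc)
  show "unbounded_in_moduli ?h"
    by (rule unbounded_in_moduli_long_torus)
  fix G :: "nat \<Rightarrow> real^2 \<Rightarrow> real^2 \<Rightarrow> real" and y :: "real^2"
  assume G: "\<forall>k. green_function (?h k) (G k)"
  define C where "C k = (SUP t\<in>{0<..}. ennreal (t^2) * emeasure (torus_vol (?h k))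
    {x. x - y \<notin> int_lattice \<and> norm_differential (?h k) (\<lambda>z. G k z y) x \<ge> t})" for k
  have bound: "ennreal (real (Suc k) / (2 * pi)) \<le> 1 + 2 * C k" for k
    unfolding C_def using G by (intro green_gradient_lower_bound) simp_all
  have "(C \<longlongrightarrow> top) sequentially"
    unfolding tendsto_top_iff_ennreal
  proof (intro allI impI)
    fix l :: real assume l: "0 \<le> l"
    \<comment> \<open>Beyond this threshold \<open>C k \<le> l\<close> is impossible, since
      \<open>bound\<close> would then give \<open>k + 1 \<le> 2 * pi * (1 + 2 * l)\<close>.\<close>
    have "\<forall>\<^sub>F k in sequentially. 2 * pi * (1 + 2 * l) < real k"
      using filterlim_real_sequentially by (simp add: filterlim_at_top_dense)
    then show "\<forall>\<^sub>F k in sequentially. ennreal l < C k"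
    proof eventually_elim
      case (elim k)
      show ?case
      proof (rule ccontr)
        assume "\<not> ennreal l < C k"
        then have "1 + 2 * C k \<le> 1 + 2 * ennreal l"
          by (intro add_left_mono mult_left_mono) auto
        also have "\<dots> = ennreal (1 + 2 * l)"
          using l by (simp add: ennreal_mult)
        finally have "ennreal (real (Suc k) / (2 * pi)) \<le> ennreal (1 + 2 * l)"
          using bound[of k] by (rule order_trans[rotated])
        then have "real (Suc k) / (2 * pi) \<le> 1 + 2 * l"
          using l by (subst (asm) ennreal_le_iff) auto
        then show False using elim by (simp add: field_simps)
      qed
    qed
  qed
  then show "(\<lambda>k. SUP t\<in>{0<..}. ennreal (t^2) * emeasure (torus_vol (?h k))
      {x. x - y \<notin> int_lattice \<and> norm_differential (?h k) (\<lambda>z. G k z y) x \<ge> t}) \<longlonglongrightarrow> \<infinity>"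
    unfolding C_def[abs_def] infinity_ennreal_def .
qed

end
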